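(* Let $n\in\{2,3,\ldots\}$ and $c_2,\ldots,c_n\in\mathbb{N}$. Consider the finite index subgroups $U$ of the Houghton group $H_n$ with $\pi(U)=\langle c_2e_1,\ldots,c_ne_{n-1}\rangle$. Then: - if at least two of $c_2,\ldots,c_n$ are odd, every such $U$ equals $\langle g_2^{c_2},\ldots,g_n^{c_n},\mathrm{FSym}(X_n)\rangle$; - otherwise, there are exactly $2^{n-1}+1$ such subgroups $U$ of $H_n$.
   Context: $\mathbb{N}=\{1,2,\ldots\}$. Permutations act on the right, so products are composed left to right. For a set $X$, $\mathrm{FSym}(X)$ is the group of bijections of $X$ with finite support. For $n\ge 2$ let $X_n=\{1,\ldots,n\}\times\mathbb{N}$ and, for $k\in\{2,\ldots,n\}$, let $g_k\in\mathrm{Sym}(X_n)$ be defined by $(1,m)g_k=(1,m+1)$ for $m\in\mathbb{N}$; $(k,1)g_k=(1,1)$; $(k,m)g_k=(k,m-1)$ for $m\ge2$; and $(i,m)g_k=(i,m)$ for $i\notin\{1,k\}$. For $n\ge3$ the Houghton group is $H_n=\langle g_2,\ldots,g_n\rangle$; for $n=2$, $H_2=\langle ((1,1)\;(1,2)),\, g_2\rangle$, where $((1,1)\;(1,2))$ is the transposition swapping $(1,1)$ and $(1,2)$. One has $\mathrm{FSym}(X_n)\le H_n$ for all $n\ge2$, and there is a surjective homomorphism $\pi:H_n\to\mathbb{Z}^{n-1}$ with kernel $\mathrm{FSym}(X_n)$ and $\pi(g_i)=e_{i-1}$ for $i=2,\ldots,n$, where $e_1,\ldots,e_{n-1}$ is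 the standard basis of $\mathbb{Z}^{n-1}$. *)

theory Defs
  imports "HOL-Algebra.Product_Groups" "HOL-Combinatorics.Permutations"
begin

section \<open>Permutations acting on the right\<close>

definition right_sym_group :: "'a set \<Rightarrow> ('a \<Rightarrow> 'a) monoid"
  where "right_sym_group X = \<lparr>carrier = {f. f permutes X}, monoid.mult = (\<lambda>f g. g \<circ> f), one = id\<rparr>"

definition FSym :: "'a set \<Rightarrow> ('a \<Rightarrow> 'a) set"
  where "FSym X = {f. f permutes X \<and> finite {x. f x \<noteq> x}}"

definition finite_index_subgroup :: "'a set \<Rightarrow> ('a, 'b) monoid_scheme \<Rightarrow> bool"
  where "finite_index_subgroup U G \<longleftrightarrow> subgroup U G \<and> finite (rcosets\<^bsub>G\<^esub> U)"

section \<open>Houghton groups\<close>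

definition houghton_space :: "nat \<Rightarrow> (nat \<times> nat) set"
  where "houghton_space n = {1..n} \<times> {1..}"

text \<open>As an element of the symmetric group on \<open>X\<^sub>n\<close>, the generator \<open>g\<^sub>k\<close> is extended by the identity to
  all pairs; in particular pairs with second component \<open>0\<close> are fixed.\<close>

definition houghton_gen :: "nat \<Rightarrow> nat \<times> nat \<Rightarrow> nat \<times> nat"
  where "houghton_gen k = (\<lambda>(i, m).
    if m = 0 then (i, m)
    else if i = 1 then (1, m + 1)
    else if i = k then (if m = 1 then (1, 1) else (k, m - 1))
    else (i, m))"

definition houghton_gens :: "nat \<Rightarrow> (nat \<times> nat \<Rightarrow> nat \<times> nat) set"
  where "houghton_gens n =
    (if n = 2 then {transpose (1, 1) (1, 2), houghton_gen 2} else houghton_gen ` {2..n})"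

definition houghton_group :: "nat \<Rightarrow> (nat \<times> nat \<Rightarrow> nat \<times> nat) monoid"
  where "houghton_group n =
    (right_sym_group (houghton_space n))
      \<lparr>carrier := generate (right_sym_group (houghton_space n)) (houghton_gens n)\<rparr>"

section \<open>The projection onto the free abelian group of rank \<open>n - 1\<close>\<close>

definition int_power_group :: "nat \<Rightarrow> (nat \<Rightarrow> int) monoid"
  where "int_power_group r = product_group {1..r} (\<lambda>_. integer_group)"

definition std_basis :: "nat \<Rightarrow> nat \<Rightarrow> nat \<Rightarrow> int"
  where "std_basis r j = (\<lambda>i\<in>{1..r}. if i = j then 1 else 0)"

text \<open>Every element of the Houghton group is eventually a translation on each ray. The \<open>j\<close>-th
  coordinate of the projection is the amount by which points far out on the ray \<open>j + 1\<close> are moved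
  towards the origin. The theorems \<open>houghton_proj\<close> and \<open>houghton_proj_unique\<close> below show that this is
  the unique homomorphism with kernel \<open>FSym\<close> that maps \<open>g\<^sub>i\<close> to \<open>e\<^sub>i\<^sub>-\<^sub>1\<close>, and that it is
  surjective.\<close>

definition houghton_proj :: "nat \<Rightarrow> (nat \<times> nat \<Rightarrow> nat \<times> nat) \<Rightarrow> nat \<Rightarrow> int"
  where "houghton_proj n h =
    (\<lambda>j\<in>{1..n - 1}. THE t. \<forall>\<^sub>F m in sequentially.
       fst (h (j + 1, m)) = j + 1 \<and> int (snd (h (j + 1, m))) = int m - t)"

text \<open>The finite index subgroups \<open>U\<close> with \<open>\<pi>(U) = \<langle>c\<^sub>2 e\<^sub>1, \<dots>, c\<^sub>n e\<^sub>n\<^sub>-\<^sub>1\<rangle>\<close>; the power \<open>[^]\<close> is the multiple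
  \<open>c\<^sub>k e\<^sub>k\<^sub>-\<^sub>1\<close>, written multiplicatively.\<close>

definition houghton_subgroups :: "nat \<Rightarrow> (nat \<Rightarrow> nat) \<Rightarrow> (nat \<times> nat \<Rightarrow> nat \<times> nat) set set"
  where "houghton_subgroups n c = {U. finite_index_subgroup U (houghton_group n) \<and>
    houghton_proj n ` U = generate (int_power_group (n - 1))
      {std_basis (n - 1) (k - 1) [^]\<^bsub>int_power_group (n - 1)\<^esub> c k | k. k \<in> {2..n}}}"

subsection \<open>Basic facts about the groups involved\<close>

lemma right_sym_group_simps [simp]:
  "carrier (right_sym_group X) = {f. f permutes X}"
  "f \<otimes>\<^bsub>right_sym_group X\<^esub> g = g \<circ> f"
  "\<one>\<^bsub>right_sym_group X\<^esub> = id"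
  by (simp_all add: right_sym_group_def)

lemma group_right_sym_group: "group (right_sym_group X)"
proof (rule groupI)
  fix f assume "f \<in> carrier (right_sym_group X)"
  then show "\<exists>g\<in>carrier (right_sym_group X). g \<otimes>\<^bsub>right_sym_group X\<^esub> f = \<one>\<^bsub>right_sym_group X\<^esub>"
    by (intro bexI[of _ "Hilbert_Choice.inv f"])
      (auto simp: permutes_inv permutes_inv_o)
qed (auto simp: permutes_compose permutes_id comp_assoc)

lemma inv_right_sym_group:
  assumes "f permutes X"
  shows "inv\<^bsub>right_sym_group X\<^esub> f = Hilbert_Choice.inv f"
  using assms
  by (intro group.inv_equality[OF group_right_sym_group]) (auto simp: permutes_inv permutes_inv_o)

lemma bij_permutesI: "bij f \<Longrightarrow> (\<And>x. x \<notin> X \<Longrightarrow> f x = x) \<Longrightarrow> f permutes X"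
  unfolding permutes_def bij_iff by blast

lemma houghton_gen_permutes:
  assumes "2 \<le> k" "k \<le> n"
  shows "houghton_gen k permutes houghton_space n"
proof (rule bij_permutesI)
  let ?g = "\<lambda>(i, m). if m = 0 then (i, m) else if i = k then (k, m + 1)
     else if i = 1 then (if m = 1 then (k, 1) else (1, m - 1)) else (i, m)"
  show "bij (houghton_gen k)"
    by (rule o_bij[of ?g]) (use assms in \<open>auto simp: houghton_gen_def fun_eq_iff\<close>)
  show "houghton_gen k x = x" if "x \<notin> houghton_space n" for x
    using that assms by (auto simp: houghton_gen_def houghton_space_def split: prod.splits)
qed

lemma transpose_permutes: "a \<in> X \<Longrightarrow> b \<in> X \<Longrightarrow> transpose a b permutes X"
  by (rule permutes_swap_id)

lemma houghton_gens_permutes: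
  assumes "2 \<le> n" "f \<in> houghton_gens n"
  shows "f permutes houghton_space n"
  using assms houghton_gen_permutes[of _ n]
  by (auto simp: houghton_gens_def houghton_space_def split: if_splits intro!: transpose_permutes)

lemma houghton_subgroup:
  assumes "2 \<le> n"
  shows "subgroup (carrier (houghton_group n)) (right_sym_group (houghton_space n))"
proof -
  have "houghton_gens n \<subseteq> carrier (right_sym_group (houghton_space n))"
    using houghton_gens_permutes[OF assms] by auto
  from group.generate_is_subgroup[OF group_right_sym_group this] show ?thesis
    by (simp add: houghton_group_def)
qed

lemma group_houghton_group:
  assumes "2 \<le> n"
  shows "group (houghton_group n)"
proof -
  have "houghton_group n =
      (right_sym_group (houghton_space n))\<lparr>carrier := carrier (houghton_group n)\<rparr>"
    by (simp add: houghton_group_def)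
  then show ?thesis
    using subgroup.subgroup_is_group[OF houghton_subgroup[OF assms] group_right_sym_group] by simp
qed

lemma houghton_group_simps [simp]:
  "f \<otimes>\<^bsub>houghton_group n\<^esub> g = g \<circ> f"
  "\<one>\<^bsub>houghton_group n\<^esub> = id"
  by (simp_all add: houghton_group_def)

lemma houghton_permutes:
  "2 \<le> n \<Longrightarrow> h \<in> carrier (houghton_group n) \<Longrightarrow> h permutes houghton_space n"
  using subgroup.subset[OF houghton_subgroup, of n] by auto

lemma houghton_comp:
  "2 \<le> n \<Longrightarrow> f \<in> carrier (houghton_group n) \<Longrightarrow> g \<in> carrier (houghton_group n) \<Longrightarrow>
     g \<circ> f \<in> carrier (houghton_group n)"
  using subgroup.m_closed[OF houghton_subgroup, of n f g] by simp

lemma houghton_id: "2 \<le> n \<Longrightarrow> id \<in> carrier (houghton_group n)"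
  using subgroup.one_closed[OF houghton_subgroup, of n] by simp

lemma houghton_inv:
  "2 \<le> n \<Longrightarrow> f \<in> carrier (houghton_group n) \<Longrightarrow>
     Hilbert_Choice.inv f \<in> carrier (houghton_group n)"
  using subgroup.m_inv_closed[OF houghton_subgroup, of n f] houghton_permutes[of n f]
  by (simp add: inv_right_sym_group)

lemma houghton_gens_mem: "f \<in> houghton_gens n \<Longrightarrow> f \<in> carrier (houghton_group n)"
  by (simp add: houghton_group_def generate.incl)

lemma houghton_gen_mem: "2 \<le> k \<Longrightarrow> k \<le> n \<Longrightarrow> houghton_gen k \<in> carrier (houghton_group n)"
  by (rule houghton_gens_mem) (auto simp: houghton_gens_def)

lemma houghton_induct [consumes 2, case_names one gen inv comp]:
  assumes n: "2 \<le> n" and h: "h \<in> carrier (houghton_group n)"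
    and "P id"
    and gen: "\<And>f. f \<in> houghton_gens n \<Longrightarrow> P f"
    and inv: "\<And>f. f \<in> houghton_gens n \<Longrightarrow> P f \<Longrightarrow> P (Hilbert_Choice.inv f)"
    and comp: "\<And>f g. f \<in> carrier (houghton_group n) \<Longrightarrow> g \<in> carrier (houghton_group n) \<Longrightarrow>
      P f \<Longrightarrow> P g \<Longrightarrow> P (g \<circ> f)"
  shows "P h"
proof -
  have "h \<in> generate (right_sym_group (houghton_space n)) (houghton_gens n)"
    using h by (simp add: houghton_group_def)
  then show ?thesis
  proof induction
    case one
    then show ?case using \<open>P id\<close> unfolding right_sym_group_simps .
  next
    case (incl f)
    then show ?case by (rule gen)
  next
    case (inv f)
    then show ?case
      using assms(5) gen houghton_gens_permutes[OF n] by (simp add: inv_right_sym_group)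
  next
    case (eng f g)
    then have "P (g \<circ> f)" by (intro comp) (simp_all add: houghton_group_def)
    then show ?case unfolding right_sym_group_simps .
  qed
qed

lemma group_int_power_group: "group (int_power_group r)"
  by (simp add: int_power_group_def)

subsection \<open>Finitary permutations belong to the Houghton group\<close>

lemma transpose_conj:
  assumes "bij f"
  shows "f \<circ> transpose a b \<circ> Hilbert_Choice.inv f = transpose (f a) (f b)"
proof
  fix x
  obtain y where "x = f y" using assms by (metis bij_pointE)
  then show "(f \<circ> transpose a b \<circ> Hilbert_Choice.inv f) x = transpose (f a) (f b) x"
    using assms by (auto simp: transpose_def bij_is_inj inj_eq)
qed

lemma houghton_transpose_conj:
  assumes n: "2 \<le> n" and h: "h \<in> carrier (houghton_group n)"
    and "transpose a b \<in> carrier (houghton_group n)"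
  shows "transpose (h a) (h b) \<in> carrier (houghton_group n)"
proof -
  have "bij h" using houghton_permutes[OF n h] permutes_bij by blast
  then show ?thesis
    using assms by (metis transpose_conj houghton_comp houghton_inv)
qed

lemma houghton_transpose_trans:
  assumes n: "2 \<le> n"
    and ab: "transpose a b \<in> carrier (houghton_group n)"
    and bc: "transpose b c \<in> carrier (houghton_group n)"
  shows "transpose a c \<in> carrier (houghton_group n)"
proof (cases "a = c \<or> a = b")
  case True
  then show ?thesis using houghton_id[OF n] bc by (auto simp: id_def)
next
  case False
  then show ?thesis
    using houghton_transpose_conj[OF n bc ab] by simp
qed

lemma houghton_transpose_base:
  assumes n: "2 \<le> n"
  shows "transpose (1, 1) (1, 2) \<in> carrier (houghton_group n)"
proof (cases "n = 2")
  case True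
  then show ?thesis by (intro houghton_gens_mem) (simp add: houghton_gens_def)
next
  case False
  let ?a = "houghton_gen 2" and ?b = "houghton_gen 3"
  let ?t = "transpose (1, 1) (1, 2) :: nat \<times> nat \<Rightarrow> nat \<times> nat"
  have mem: "?a \<in> carrier (houghton_group n)" "?b \<in> carrier (houghton_group n)"
    using n False by (auto intro!: houghton_gen_mem)
  have ba: "?b \<circ> ?a \<in> carrier (houghton_group n)" and ab: "?a \<circ> ?b \<in> carrier (houghton_group n)"
    using mem houghton_comp[OF n] by blast+
  have eq: "?t \<circ> (?b \<circ> ?a) = ?a \<circ> ?b"
  proof
    fix x :: "nat \<times> nat"
    obtain i m where x: "x = (i, m)" by (cases x)
    consider "m = 0" | "m \<ge> 1" "i = 1" | "i = 2" "m = 1" | "i = 2" "m \<ge> 2"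
      | "i = 3" "m = 1" | "i = 3" "m \<ge> 2" | "m \<ge> 1" "i \<notin> {1, 2, 3}"
      by (atomize_elim, simp, arith)
    then show "(?t \<circ> (?b \<circ> ?a)) x = (?a \<circ> ?b) x"
      unfolding x by cases (simp_all add: houghton_gen_def transpose_def)
  qed
  have "?a \<circ> ?b \<circ> Hilbert_Choice.inv (?b \<circ> ?a) =
      ?t \<circ> ((?b \<circ> ?a) \<circ> Hilbert_Choice.inv (?b \<circ> ?a))"
    unfolding eq[symmetric] by (rule comp_assoc)
  also have "\<dots> = ?t"
    by (simp only: permutes_inv_o(1)[OF houghton_permutes[OF n ba]] comp_id)
  finally have "?a \<circ> ?b \<circ> Hilbert_Choice.inv (?b \<circ> ?a) = ?t" .
  then show ?thesis
    using houghton_comp[OF n houghton_inv[OF n ba] ab] by simp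
qed

lemma houghton_transpose_origin:
  assumes n: "2 \<le> n" and x: "x \<in> houghton_space n"
  shows "transpose x (1, 1) \<in> carrier (houghton_group n)"
proof -
  let ?H = "carrier (houghton_group n)"
  have first: "transpose (1, Suc m) (1, Suc (Suc m)) \<in> ?H" for m
  proof (induction m)
    case 0
    then show ?case using houghton_transpose_base[OF n] by (simp add: numeral_2_eq_2)
  next
    case (Suc m)
    show ?case
      using houghton_transpose_conj[OF n houghton_gen_mem Suc, of 2] n by (simp add: houghton_gen_def)
  qed
  have ray1: "transpose (1, Suc m) (1, 1) \<in> ?H" for m
  proof (induction m)
    case 0
    then show ?case using houghton_id[OF n] by (simp add: id_def)
  next
    case (Suc m)
    have "transpose (1, Suc (Suc m)) (1, Suc m) \<in> ?H"
      using first[of m] by (subst transpose_commute)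
    then show ?case by (rule houghton_transpose_trans[OF n _ Suc])
  qed
  have rayk: "transpose (k, Suc m) (1, 1) \<in> ?H" if k: "2 \<le> k" "k \<le> n" for k m
  proof -
    let ?i = "Hilbert_Choice.inv (houghton_gen k)"
    have mem: "?i \<in> ?H" using houghton_inv[OF n houghton_gen_mem[OF k]] .
    have i: "?i y = x" if "houghton_gen k x = y" for x y
      using that houghton_gen_permutes[OF k] by (metis permutes_inv_eq)
    have i1: "?i (1, 1) = (k, 1)" by (rule i) (use k in \<open>simp add: houghton_gen_def\<close>)
    have i2: "?i (1, 2) = (1, 1)" by (rule i) (use k in \<open>simp add: houghton_gen_def\<close>)
    have i3: "?i (k, Suc m) = (k, Suc (Suc m))" for m
      by (rule i) (use k in \<open>simp add: houghton_gen_def\<close>)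
    have base: "transpose (k, 1) (1, 1) \<in> ?H"
      using houghton_transpose_conj[OF n mem houghton_transpose_base[OF n]] unfolding i1 i2 .
    show ?thesis
    proof (induction m)
      case 0
      then show ?case using base by simp
    next
      case (Suc m)
      show ?case
        using houghton_transpose_trans[OF n houghton_transpose_conj[OF n mem Suc, unfolded i1 i3] base] .
    qed
  qed
  obtain k m where "x = (k, Suc m)" "1 \<le> k" "k \<le> n"
    using x by (cases x; cases "snd x") (auto simp: houghton_space_def)
  then show ?thesis using ray1[of m] rayk[of k m] by (cases "k = 1") auto
qed

lemma FSym_subset_houghton:
  assumes n: "2 \<le> n"
  shows "FSym (houghton_space n) \<subseteq> carrier (houghton_group n)"
proof
  fix f assume f: "f \<in> FSym (houghton_space n)"
  let ?S = "{x. f x \<noteq> x}"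
  have S: "?S \<subseteq> houghton_space n" using f by (auto simp: FSym_def permutes_def)
  have "f permutes ?S"
    using f by (intro bij_permutesI) (auto simp: FSym_def permutes_bij)
  moreover have "finite ?S" using f by (simp add: FSym_def)
  ultimately show "f \<in> carrier (houghton_group n)"
  proof (induction rule: permutes_induct)
    case id
    then show ?case by (rule houghton_id[OF n])
  next
    case (swap a b p)
    have "a \<in> houghton_space n" "b \<in> houghton_space n" using swap(1,2) S by blast+
    then have a: "transpose a (1, 1) \<in> carrier (houghton_group n)"
      and "transpose b (1, 1) \<in> carrier (houghton_group n)"
      using houghton_transpose_origin[OF n] by blast+
    then have "transpose (1, 1) b \<in> carrier (houghton_group n)"
      by (subst transpose_commute)
    with a have "transpose a b \<in> carrier (houghton_group n)"
      by (rule houghton_transpose_trans[OF n])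
    with swap.IH show ?case by (rule houghton_comp[OF n])
  qed
qed

subsection \<open>Eventual translations\<close>

definition eventual_shift :: "nat \<Rightarrow> (nat \<times> nat \<Rightarrow> nat \<times> nat) \<Rightarrow> (nat \<Rightarrow> int) \<Rightarrow> bool"
  where "eventual_shift n h s \<longleftrightarrow>
    (\<forall>k\<in>{1..n}. \<forall>\<^sub>F m in sequentially. h (k, m) = (k, nat (int m - s k))) \<and> sum s {1..n} = 0"

lemma eventually_ge_nat: "\<forall>\<^sub>F m in sequentially. int m \<ge> c"
  using eventually_ge_at_top[of "nat c"] by eventually_elim simp

lemma eventual_shift_comp:
  assumes "eventual_shift n f s" "eventual_shift n g t"
  shows "eventual_shift n (g \<circ> f) (\<lambda>k. s k + t k)"
  unfolding eventual_shift_def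
proof (intro conjI ballI)
  fix k assume k: "k \<in> {1..n}"
  have f: "\<forall>\<^sub>F m in sequentially. f (k, m) = (k, nat (int m - s k))"
    and g: "\<forall>\<^sub>F m in sequentially. g (k, m) = (k, nat (int m - t k))"
    using assms k by (auto simp: eventual_shift_def)
  obtain M where M: "\<And>m. m \<ge> M \<Longrightarrow> g (k, m) = (k, nat (int m - t k))"
    using g by (auto simp: eventually_sequentially)
  show "\<forall>\<^sub>F m in sequentially. (g \<circ> f) (k, m) = (k, nat (int m - (s k + t k)))"
    using f eventually_ge_nat[of "int M + s k"]
  proof eventually_elim
    case (elim m)
    then have "nat (int m - s k) \<ge> M" by linarith
    then have "g (f (k, m)) = (k, nat (int (nat (int m - s k)) - t k))"
      using elim M by simp
    also have "int (nat (int m - s k)) = int m - s k" using elim by simp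
    finally show ?case by (simp add: diff_diff_eq)
  qed
next
  show "(\<Sum>k\<in>{1..n}. s k + t k) = 0"
    using assms by (simp add: eventual_shift_def sum.distrib)
qed

lemma eventual_shift_inv:
  assumes "bij f" "eventual_shift n f s"
  shows "eventual_shift n (Hilbert_Choice.inv f) (\<lambda>k. - s k)"
  unfolding eventual_shift_def
proof (intro conjI ballI)
  fix k assume k: "k \<in> {1..n}"
  have "\<forall>\<^sub>F m in sequentially. f (k, m) = (k, nat (int m - s k))"
    using assms k by (auto simp: eventual_shift_def)
  then obtain M where M: "\<And>m. m \<ge> M \<Longrightarrow> f (k, m) = (k, nat (int m - s k))"
    by (auto simp: eventually_sequentially)
  show "\<forall>\<^sub>F m in sequentially.
      Hilbert_Choice.inv f (k, m) = (k, nat (int m - (- s k)))"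
    using eventually_ge_nat[of "int M - s k"] eventually_ge_nat[of "- s k"]
  proof eventually_elim
    case (elim m)
    let ?m = "nat (int m + s k)"
    have "?m \<ge> M" using elim by linarith
    then have "f (k, ?m) = (k, nat (int ?m - s k))" by (rule M)
    also have "int ?m = int m + s k" using elim by simp
    finally have "f (k, ?m) = (k, m)" by simp
    then show ?case using assms(1) by (simp add: bij_is_inj inv_f_eq)
  qed
next
  show "(\<Sum>k\<in>{1..n}. - s k) = 0"
    using assms by (simp add: eventual_shift_def sum_negf)
qed

lemma eventual_shift_FSym:
  assumes "finite {x. f x \<noteq> x}"
  shows "eventual_shift n f (\<lambda>_. 0)"
  unfolding eventual_shift_def
proof (intro conjI ballI)
  fix k assume "k \<in> {1..n}"
  have "finite (snd ` {x. f x \<noteq> x})" using assms by simp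
  then obtain M where "\<forall>m \<in> snd ` {x. f x \<noteq> x}. m \<le> M"
    by (meson finite_nat_set_iff_bounded_le)
  then have fix_tail: "f (k, m) = (k, m)" if "m > M" for m
    using that by force
  show "\<forall>\<^sub>F m in sequentially. f (k, m) = (k, nat (int m - 0))"
    using eventually_gt_at_top[of M] by eventually_elim (simp add: fix_tail)
qed simp

lemma finite_support_transpose: "finite {x. transpose a b x \<noteq> x}"
  by (rule finite_subset[of _ "{a, b}"]) (auto simp: transpose_def)

lemma eventual_shift_gen:
  assumes "2 \<le> k" "k \<le> n"
  shows "eventual_shift n (houghton_gen k) (\<lambda>i. if i = 1 then - 1 else if i = k then 1 else 0)"
  unfolding eventual_shift_def
proof (intro conjI ballI)
  fix i assume "i \<in> {1..n}"
  show "\<forall>\<^sub>F m in sequentially. houghton_gen k (i, m) =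
      (i, nat (int m - (if i = 1 then - 1 else if i = k then 1 else 0)))"
    using eventually_gt_at_top[of 1]
    by eventually_elim (use assms in \<open>auto simp: houghton_gen_def nat_diff_distrib\<close>)
next
  have "(\<Sum>i\<in>{1..n}. if i = 1 then - 1 else if i = k then 1 else 0) =
    (\<Sum>i\<in>{1..n}. (if i = 1 then - 1 else 0) + (if i = k then 1 else (0::int)))"
    using assms by (intro sum.cong) auto
  also have "\<dots> = 0" using assms by (simp add: sum.distrib)
  finally show "(\<Sum>i\<in>{1..n}. if i = 1 then - 1 else if i = k then 1 else (0::int)) = 0" .
qed

lemma eventual_shift_exists:
  assumes n: "2 \<le> n" and h: "h \<in> carrier (houghton_group n)"
  shows "\<exists>s. eventual_shift n h s"
  using n h
proof (induction rule: houghton_induct)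
  case one
  have "eventual_shift n id (\<lambda>_. 0)" by (rule eventual_shift_FSym) simp
  then show ?case by blast
next
  case (gen f)
  have "\<exists>s. eventual_shift n (transpose (1, 1) (1, 2)) s"
    using eventual_shift_FSym[OF finite_support_transpose] by blast
  then show ?case
    using gen eventual_shift_gen[of _ n] n by (fastforce simp: houghton_gens_def split: if_splits)
next
  case (inv f)
  then show ?case
    using eventual_shift_inv permutes_bij[OF houghton_gens_permutes[OF n]] by blast
next
  case (comp f g)
  then show ?case using eventual_shift_comp by blast
qed

lemma houghton_proj_eq:
  assumes "eventual_shift n h s"
  shows "houghton_proj n h = (\<lambda>j\<in>{1..n - 1}. s (j + 1))"
  unfolding houghton_proj_def
proof (rule restrict_ext, rule the_equality)
  fix j assume "j \<in> {1..n - 1}"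
  then have ev: "\<forall>\<^sub>F m in sequentially. h (j + 1, m) = (j + 1, nat (int m - s (j + 1)))"
    using assms by (auto simp: eventual_shift_def)
  show *: "\<forall>\<^sub>F m in sequentially.
      fst (h (j + 1, m)) = j + 1 \<and> int (snd (h (j + 1, m))) = int m - s (j + 1)"
    using ev eventually_ge_nat[of "s (j + 1)"] by eventually_elim simp
  fix t assume "\<forall>\<^sub>F m in sequentially.
      fst (h (j + 1, m)) = j + 1 \<and> int (snd (h (j + 1, m))) = int m - t"
  with * have "\<forall>\<^sub>F m::nat in sequentially. t = s (j + 1)"
    by eventually_elim simp
  then show "t = s (j + 1)" by simp
qed

subsection \<open>Characterization of the projection\<close>

lemma int_power_group_simps:
  "carrier (int_power_group r) = {1..r} \<rightarrow>\<^sub>E UNIV"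
  "x \<otimes>\<^bsub>int_power_group r\<^esub> y = (\<lambda>i\<in>{1..r}. x i + y i)"
  "\<one>\<^bsub>int_power_group r\<^esub> = (\<lambda>i\<in>{1..r}. 0)"
  by (simp_all add: int_power_group_def)

lemma houghton_proj_hom:
  assumes n: "2 \<le> n"
  shows "houghton_proj n \<in> hom (houghton_group n) (int_power_group (n - 1))"
proof (rule homI)
  fix f assume "f \<in> carrier (houghton_group n)"
  show "houghton_proj n f \<in> carrier (int_power_group (n - 1))"
    by (simp add: houghton_proj_def int_power_group_simps)
next
  fix f g assume f: "f \<in> carrier (houghton_group n)" and g: "g \<in> carrier (houghton_group n)"
  obtain s t where s: "eventual_shift n f s" and t: "eventual_shift n g t"
    using eventual_shift_exists[OF n] f g by blast
  show "houghton_proj n (f \<otimes>\<^bsub>houghton_group n\<^esub> g) =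
      houghton_proj n f \<otimes>\<^bsub>int_power_group (n - 1)\<^esub> houghton_proj n g"
    by (auto simp: houghton_proj_eq[OF s] houghton_proj_eq[OF t]
        houghton_proj_eq[OF eventual_shift_comp[OF s t]] int_power_group_simps)
qed

lemma houghton_proj_gen:
  assumes "2 \<le> k" "k \<le> n"
  shows "houghton_proj n (houghton_gen k) = std_basis (n - 1) (k - 1)"
  using assms by (auto simp: houghton_proj_eq[OF eventual_shift_gen[OF assms]] std_basis_def fun_eq_iff)

lemma houghton_proj_kernel:
  assumes n: "2 \<le> n"
  shows "kernel (houghton_group n) (int_power_group (n - 1)) (houghton_proj n) =
    FSym (houghton_space n)"
proof (intro subset_antisym subsetI)
  fix h assume "h \<in> FSym (houghton_space n)"
  then show "h \<in> kernel (houghton_group n) (int_power_group (n - 1)) (houghton_proj n)"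
    using FSym_subset_houghton[OF n] houghton_proj_eq[OF eventual_shift_FSym, of h n]
    by (auto simp: kernel_def FSym_def int_power_group_simps)
next
  fix h assume "h \<in> kernel (houghton_group n) (int_power_group (n - 1)) (houghton_proj n)"
  then have h: "h \<in> carrier (houghton_group n)"
    and 0: "houghton_proj n h = (\<lambda>i\<in>{1..n - 1}. 0)"
    by (auto simp: kernel_def int_power_group_simps)
  obtain s where s: "eventual_shift n h s" using eventual_shift_exists[OF n h] by blast
  have s0: "s k = 0" if "k \<in> {2..n}" for k
  proof -
    have "k - 1 \<in> {1..n - 1}" "k - 1 + 1 = k" using that by auto
    then show ?thesis
      using houghton_proj_eq[OF s] 0 by (metis (no_types, lifting) restrict_apply')
  qed
  have "{1..n} = insert 1 {2..n}" using n by auto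
  then have "sum s {1..n} = s 1 + sum s {2..n}" by simp
  then have "s 1 = 0" using s s0 by (simp add: eventual_shift_def)
  then have all0: "s k = 0" if "k \<in> {1..n}" for k
    using s0[of k] that by (cases "k = 1") auto
  have "\<forall>k\<in>{1..n}. \<forall>\<^sub>F m in sequentially. h (k, m) = (k, m)"
    using s by (simp add: eventual_shift_def all0)
  then have "\<forall>k\<in>{1..n}. \<exists>M. \<forall>m\<ge>M. h (k, m) = (k, m)"
    by (simp add: eventually_sequentially)
  then obtain M where M: "\<And>k m. k \<in> {1..n} \<Longrightarrow> m \<ge> M k \<Longrightarrow> h (k, m) = (k, m)"
    by metis
  have perm: "h permutes houghton_space n" by (rule houghton_permutes[OF n h])
  have "{x. h x \<noteq> x} \<subseteq> (\<Union>k\<in>{1..n}. {k} \<times> {..<M k})"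
  proof
    fix x assume x: "x \<in> {x. h x \<noteq> x}"
    then have "x \<in> houghton_space n" using permutes_not_in[OF perm] by blast
    then obtain k m where "x = (k, m)" "k \<in> {1..n}" by (auto simp: houghton_space_def)
    then show "x \<in> (\<Union>k\<in>{1..n}. {k} \<times> {..<M k})"
      using x M[of k m] by (cases "m < M k") auto
  qed
  then have "finite {x. h x \<noteq> x}"
    by (rule finite_subset) auto
  with perm show "h \<in> FSym (houghton_space n)" by (simp add: FSym_def)
qed

lemma houghton_proj_surj:
  assumes n: "2 \<le> n"
  shows "houghton_proj n ` carrier (houghton_group n) = carrier (int_power_group (n - 1))"
proof
  show "houghton_proj n ` carrier (houghton_group n) \<subseteq> carrier (int_power_group (n - 1))"
    by (auto simp: houghton_proj_def int_power_group_simps)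
  let ?I = "houghton_proj n ` carrier (houghton_group n)"
  have step: "(\<lambda>i\<in>{1..n - 1}. z i + (if i = j then c else 0)) \<in> ?I"
    if z: "z \<in> ?I" and j: "j \<in> {1..n - 1}" and c: "c = 1 \<or> c = - 1" for z j and c :: int
  proof -
    obtain f s where f: "f \<in> carrier (houghton_group n)" "z = houghton_proj n f"
      and s: "eventual_shift n f s" using z eventual_shift_exists[OF n] by blast
    have k: "2 \<le> j + 1" "j + 1 \<le> n" using j by auto
    let ?g = "houghton_gen (j + 1)"
    note g = houghton_gen_mem[OF k] eventual_shift_gen[OF k]
    define h where "h = (if c = 1 then ?g else Hilbert_Choice.inv ?g)"
    have "\<exists>t. eventual_shift n h t \<and> (\<forall>i\<in>{1..n - 1}. t (i + 1) = (if i = j then c else 0))"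
      using g(2) eventual_shift_inv[OF permutes_bij[OF houghton_gen_permutes[OF k]] g(2)] c
      by (cases "c = 1") (force simp: h_def)+
    then obtain t where t: "eventual_shift n h t"
      "\<forall>i\<in>{1..n - 1}. t (i + 1) = (if i = j then c else 0)" by blast
    have "h \<circ> f \<in> carrier (houghton_group n)"
      using houghton_comp[OF n f(1)] g(1) houghton_inv[OF n g(1)] by (simp add: h_def)
    moreover have "houghton_proj n (h \<circ> f) = (\<lambda>i\<in>{1..n - 1}. z i + (if i = j then c else 0))"
      unfolding houghton_proj_eq[OF eventual_shift_comp[OF s t(1)]] f(2) houghton_proj_eq[OF s]
      by (intro restrict_ext) (use t(2) in auto)
    ultimately show ?thesis by (metis imageI)
  qed
  have add: "(\<lambda>i\<in>{1..n - 1}. z i + (if i = j then c else 0)) \<in> ?I"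
    if z: "z \<in> ?I" and j: "j \<in> {1..n - 1}" for z j and c :: int
  proof (induction c rule: int_induct[of _ 0])
    case base
    have "(\<lambda>i\<in>{1..n - 1}. z i + (if i = j then 0 else 0)) = z"
      using z by (auto simp: houghton_proj_def fun_eq_iff)
    then show ?case using z by simp
  next
    case (step1 c)
    have "(\<lambda>i\<in>{1..n - 1}. z i + (if i = j then c + 1 else 0)) =
      (\<lambda>i\<in>{1..n - 1}. (\<lambda>i\<in>{1..n - 1}. z i + (if i = j then c else 0)) i + (if i = j then 1 else 0))"
      by (intro restrict_ext) auto
    then show ?case using step[OF step1(2) j, of 1] by (simp only: simp_thms)
  next
    case (step2 c)
    have "(\<lambda>i\<in>{1..n - 1}. z i + (if i = j then c - 1 else 0)) =
      (\<lambda>i\<in>{1..n - 1}. (\<lambda>i\<in>{1..n - 1}. z i + (if i = j then c else 0)) i + (if i = j then - 1 else 0))"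
      by (intro restrict_ext) auto
    then show ?case using step[OF step2(2) j, of "- 1"] by (simp only: simp_thms)
  qed
  have supp: "(\<lambda>i\<in>{1..n - 1}. if i \<in> J then z i else 0) \<in> ?I"
    if "finite J" "J \<subseteq> {1..n - 1}" for J z
    using that
  proof (induction J)
    case empty
    have "houghton_proj n id = (\<lambda>i\<in>{1..n - 1}. 0)"
      using houghton_proj_eq[OF eventual_shift_FSym, of id n] by simp
    then show ?case using imageI[OF houghton_id[OF n], of "houghton_proj n"]
      by (simp only: empty_iff if_False)
  next
    case (insert j J)
    have "(\<lambda>i\<in>{1..n - 1}. if i \<in> insert j J then z i else 0) =
      (\<lambda>i\<in>{1..n - 1}. (\<lambda>i\<in>{1..n - 1}. if i \<in> J then z i else 0) i + (if i = j then z j else 0))"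
      using insert by (intro restrict_ext) auto
    moreover have "(\<lambda>i\<in>{1..n - 1}. if i \<in> J then z i else 0) \<in> ?I" and "j \<in> {1..n - 1}"
      using insert by blast+
    ultimately show ?case using add by (simp only:)
  qed
  show "carrier (int_power_group (n - 1)) \<subseteq> ?I"
  proof
    fix z assume "z \<in> carrier (int_power_group (n - 1))"
    then have "z = (\<lambda>i\<in>{1..n - 1}. if i \<in> {1..n - 1} then z i else 0)"
      by (auto simp: int_power_group_simps fun_eq_iff PiE_def extensional_def)
    then show "z \<in> ?I" using supp[of "{1..n - 1}" z] by simp
  qed
qed

theorem houghton_proj:
  assumes "2 \<le> n"
  shows "houghton_proj n \<in> epi (houghton_group n) (int_power_group (n - 1))"
    and "kernel (houghton_group n) (int_power_group (n - 1)) (houghton_proj n) =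
      FSym (houghton_space n)"
    and "\<And>i. i \<in> {2..n} \<Longrightarrow> houghton_proj n (houghton_gen i) = std_basis (n - 1) (i - 1)"
  using houghton_proj_hom houghton_proj_surj houghton_proj_kernel houghton_proj_gen assms
  by (auto simp: epi_def)

theorem houghton_proj_unique:
  assumes n: "2 \<le> n"
    and hom: "\<phi> \<in> hom (houghton_group n) (int_power_group (n - 1))"
    and ker: "kernel (houghton_group n) (int_power_group (n - 1)) \<phi> = FSym (houghton_space n)"
    and gens: "\<And>i. i \<in> {2..n} \<Longrightarrow> \<phi> (houghton_gen i) = std_basis (n - 1) (i - 1)"
    and h: "h \<in> carrier (houghton_group n)"
  shows "\<phi> h = houghton_proj n h"
proof -
  let ?H = "houghton_group n" and ?Z = "int_power_group (n - 1)"
  interpret f: group_hom ?H ?Z \<phi>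
    using hom group_houghton_group[OF n] group_int_power_group
    by (simp add: group_hom_def group_hom_axioms_def)
  interpret p: group_hom ?H ?Z "houghton_proj n"
    using houghton_proj_hom[OF n] group_houghton_group[OF n] group_int_power_group
    by (simp add: group_hom_def group_hom_axioms_def)
  have eq: "\<phi> f = houghton_proj n f" if f: "f \<in> houghton_gens n" for f
  proof (cases "f \<in> houghton_gen ` {2..n}")
    case True
    then show ?thesis using gens houghton_proj_gen[of _ n] by auto
  next
    case False
    then have "f = transpose (1, 1) (1, 2)" using f n by (auto simp: houghton_gens_def split: if_splits)
    then have "f \<in> FSym (houghton_space n)"
      using houghton_gens_permutes[OF n f] by (simp add: FSym_def finite_support_transpose)
    then have "f \<in> kernel ?H ?Z \<phi>" "f \<in> kernel ?H ?Z (houghton_proj n)"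
      using ker houghton_proj_kernel[OF n] by simp_all
    then show ?thesis by (simp add: kernel_def)
  qed
  have inv: "Hilbert_Choice.inv f = inv\<^bsub>?H\<^esub> f" if "f \<in> carrier ?H" for f
    using that houghton_inv[OF n that] permutes_inv_o[OF houghton_permutes[OF n that]]
    by (intro f.G.inv_equality[symmetric]) auto
  from n h show ?thesis
  proof (induction rule: houghton_induct)
    case one
    have "\<phi> id = houghton_proj n id" using f.hom_one p.hom_one by (simp only: houghton_group_simps)
    then show ?case .
  next
    case (gen f)
    then show ?case by (rule eq)
  next
    case (inv f)
    then show ?case
      using houghton_gens_mem[OF inv(1)] by (simp add: \<open>\<And>f. f \<in> carrier ?H \<Longrightarrow> Hilbert_Choice.inv f = inv\<^bsub>?H\<^esub> f\<close>)
  next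
    case (comp f g)
    then have "\<phi> (g \<circ> f) = houghton_proj n (g \<circ> f)"
      using f.hom_mult[of f g] p.hom_mult[of f g] by (simp only: houghton_group_simps)
    then show ?case .
  qed
qed

end

(* A finite index subgroup U of H_n contains the finitary alternating group A, by a pigeonhole argument
   on the cosets of transpositions. As A has index 2 in FSym, the subgroup FSym is central modulo A, and
   the sign kappa of commutators is a bimultiplicative symmetric map on H_n that is trivial on FSym.
   On generators kappa (g_i, g_j) = -1 for i \<noteq> j, so kappa (g_i^c_i, g_j^c_j) = (-1)^(c_i c_j).
   If two of the exponents are odd, U contains an odd permutation, hence FSym, and U is the full
   preimage of its image. Otherwise the lifts g_k^c_k commute modulo A, and the subgroups U with
   U \<inter> FSym = A are obtained by choosing for each k which of the two lifts g_k^c_k and g_k^c_k t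
   (t a transposition) lies in U; the full preimage is the one further subgroup. *)

theory Submission
  imports Defs
begin

section \<open>Subgroups with prescribed image in a sign extension\<close>

text \<open>For \<open>g\<close> in \<open>U\<close>, choose \<open>w\<close> in \<open>W\<close>
  with the same image. Then \<open>inv w \<otimes> g\<close> lies in \<open>U\<close> and in the
  kernel, hence in \<open>W\<close>.\<close>

lemma (in group_hom) subset_if_image_and_kernel_subset:
  assumes "subgroup U G" "subgroup W G" "W \<subseteq> U" "h ` U \<subseteq> h ` W" "U \<inter> kernel G H h \<subseteq> W"
  shows "U \<subseteq> W"
proof
  fix g assume g: "g \<in> U"
  then obtain w where w: "w \<in> W" "h w = h g" using assms(4) by force
  have car: "g \<in> carrier G" "w \<in> carrier G"
    using g w assms subgroup.mem_carrier by metis+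
  have "inv w \<otimes> g \<in> U"
    using assms g w by (meson subgroup.m_closed subgroup.m_inv_closed subsetD)
  moreover have "inv w \<otimes> g \<in> kernel G H h"
    using car w by (simp add: kernel_def)
  ultimately have "w \<otimes> (inv w \<otimes> g) \<in> W"
    using assms w by (meson IntI subgroup.m_closed subsetD)
  then show "g \<in> W" using car by (simp flip: G.m_assoc)
qed

text \<open>Elements of \<open>S\<close> map to the identity, which adds nothing to a generated
  subgroup. It is applied with \<open>S = A\<close> and with \<open>S\<close> the whole
  kernel.\<close>

lemma (in group_hom) image_generate_Un_kernel:
  assumes w: "w ` J \<subseteq> carrier G" and S: "S \<subseteq> kernel G H h" "\<one> \<in> S"
  shows "h ` generate G (w ` J \<union> S) = generate H ((h \<circ> w) ` J)"
proof -
  have car: "w ` J \<union> S \<subseteq> carrier G" using w S(1) by (auto simp: kernel_def)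
  have "h ` generate G (w ` J \<union> S) = generate H (h ` (w ` J \<union> S))"
    by (rule generate_img[OF car, symmetric])
  also have "h ` (w ` J \<union> S) = insert \<one>\<^bsub>H\<^esub> ((h \<circ> w) ` J)"
    using S by (force simp: kernel_def image_iff)
  also have "generate H (insert \<one>\<^bsub>H\<^esub> ((h \<circ> w) ` J)) = generate H ((h \<circ> w) ` J)"
  proof (rule subset_antisym)
    have "(h \<circ> w) ` J \<subseteq> carrier H" using w by auto
    then show "generate H (insert \<one>\<^bsub>H\<^esub> ((h \<circ> w) ` J)) \<subseteq> generate H ((h \<circ> w) ` J)"
      by (intro H.generate_subgroup_incl H.generate_is_subgroup)
        (auto intro: generate.incl generate.one)
  qed (rule H.mono_generate, blast)
  finally show ?thesis .
qed

text \<open>A subgroup containing the kernel is the full preimage of its image, so the image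
  determines it.\<close>

lemma (in group_hom) eq_generate_if_kernel_subset:
  assumes U: "subgroup U G" "kernel G H h \<subseteq> U" and u: "u ` I \<subseteq> carrier G"
    and img: "h ` U = generate H ((h \<circ> u) ` I)"
  shows "U = generate G (u ` I \<union> kernel G H h)"
proof
  let ?W = "generate G (u ` I \<union> kernel G H h)"
  have K: "kernel G H h \<subseteq> carrier G" by (auto simp: kernel_def)
  have W: "subgroup ?W G" using u K by (intro G.generate_is_subgroup) blast
  have KW: "kernel G H h \<subseteq> ?W" by (auto intro: generate.incl)
  have hW: "h ` ?W = generate H (h ` (u ` I \<union> kernel G H h))"
    using u K by (intro generate_img[symmetric]) blast
  have "generate H ((h \<circ> u) ` I) \<subseteq> h ` ?W"
    unfolding hW by (rule H.mono_generate) auto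
  then have sub: "h ` U \<subseteq> h ` ?W" using img by simp
  show WU: "?W \<subseteq> U"
  proof (rule G.generate_subgroup_incl[OF _ U(1)])
    have "u i \<in> U" if "i \<in> I" for i
    proof -
      have "h (u i) \<in> h ` U" using that img by (auto intro: generate.incl)
      \<comment> \<open>\<open>u i\<close> itself is not known to be in \<open>U\<close>, but it
        differs from \<open>v\<close> by a kernel element.\<close>
      then obtain v where v: "v \<in> U" "h v = h (u i)" by force
      have car: "v \<in> carrier G" "u i \<in> carrier G"
        using v(1) U(1) u that subgroup.mem_carrier by fastforce+
      then have "inv v \<otimes> u i \<in> kernel G H h" using v by (simp add: kernel_def)
      then have "v \<otimes> (inv v \<otimes> u i) \<in> U" using U v(1) by (meson subgroup.m_closed subsetD)
      then show ?thesis using car by (simp flip: G.m_assoc)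
    qed
    then show "u ` I \<union> kernel G H h \<subseteq> U" using U(2) by blast
  qed
  show "U \<subseteq> ?W"
    by (rule subset_if_image_and_kernel_subset[OF U(1) W WU sub]) (use KW in blast)
qed

lemma (in group) inv_mult_cancel_left:
  "x \<in> carrier G \<Longrightarrow> y \<in> carrier G \<Longrightarrow> inv x \<otimes> (x \<otimes> y) = y"
  by (simp flip: m_assoc)

text \<open>Abstracts the Houghton group over its abelian quotient, with the finitary permutations
  as kernel and \<open>t\<close> as an odd element. \<open>sgn\<close> is constrained on the kernel
  alone. Commutativity of \<open>H\<close> puts all commutators into the kernel, and
  \<open>sgn_conj\<close> holds for conjugation by the whole of \<open>G\<close>.\<close>

locale sign_extension = group_hom +
  fixes sgn :: "'a \<Rightarrow> int" and t :: 'a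
  assumes comm_H: "comm_group H"
    and sgn_mult: "\<And>x y. x \<in> kernel G H h \<Longrightarrow> y \<in> kernel G H h \<Longrightarrow> sgn (x \<otimes> y) = sgn x * sgn y"
    and sgn_conj: "\<And>g x. g \<in> carrier G \<Longrightarrow> x \<in> kernel G H h \<Longrightarrow> sgn (g \<otimes> x \<otimes> inv g) = sgn x"
    and sgn_cases: "\<And>x. x \<in> kernel G H h \<Longrightarrow> sgn x = 1 \<or> sgn x = - 1"
    and t: "t \<in> kernel G H h" "sgn t = - 1"
begin

abbreviation "K \<equiv> kernel G H h"

text \<open>\<open>K\<close> is central modulo \<open>A\<close>, which makes the sign \<open>kappa\<close> of the commutator bimultiplicative.\<close>

definition "A = {x \<in> K. sgn x = 1}"

definition "kappa x y = sgn (x \<otimes> y \<otimes> inv x \<otimes> inv y)"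

lemma K_iff: "x \<in> K \<longleftrightarrow> x \<in> carrier G \<and> h x = \<one>\<^bsub>H\<^esub>"
  by (auto simp: kernel_def)

lemma K_mult: "x \<in> K \<Longrightarrow> y \<in> K \<Longrightarrow> x \<otimes> y \<in> K"
  and K_inv: "x \<in> K \<Longrightarrow> inv x \<in> K"
  and K_one: "\<one> \<in> K"
  by (auto simp: K_iff)

lemma K_conj: "g \<in> carrier G \<Longrightarrow> x \<in> K \<Longrightarrow> g \<otimes> x \<otimes> inv g \<in> K"
  by (auto simp: K_iff)

lemma sgn_one: "sgn \<one> = 1"
  using sgn_mult[OF K_one K_one] sgn_cases[OF K_one] by auto

lemma sgn_inv: "x \<in> K \<Longrightarrow> sgn (inv x) = sgn x"
  using sgn_mult[OF K_inv, of x x] sgn_cases[of x] sgn_cases[OF K_inv, of x] sgn_one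
  by (auto simp: K_iff)

lemma comm_in_K:
  assumes "x \<in> carrier G" "y \<in> carrier G"
  shows "x \<otimes> y \<otimes> inv x \<otimes> inv y \<in> K"
proof -
  interpret H: comm_group H by (rule comm_H)
  have "h (x \<otimes> y \<otimes> inv x \<otimes> inv y) = h x \<otimes>\<^bsub>H\<^esub> h y \<otimes>\<^bsub>H\<^esub> (inv\<^bsub>H\<^esub> h x \<otimes>\<^bsub>H\<^esub> inv\<^bsub>H\<^esub> h y)"
    using assms by (simp add: H.m_assoc)
  also have "\<dots> = h x \<otimes>\<^bsub>H\<^esub> h y \<otimes>\<^bsub>H\<^esub> inv\<^bsub>H\<^esub> (h x \<otimes>\<^bsub>H\<^esub> h y)"
    using assms by (simp add: H.inv_mult)
  also have "\<dots> = \<one>\<^bsub>H\<^esub>" using assms by simp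
  finally show ?thesis using assms by (simp add: K_iff)
qed

lemma A_subset_K: "A \<subseteq> K" and t_notin_A: "t \<notin> A"
  using t by (auto simp: A_def)

lemma A_subgroup: "subgroup A G"
proof (rule G.subgroupI)
  show "A \<noteq> {}" using K_one sgn_one by (auto simp: A_def)
  show "A \<subseteq> carrier G" by (auto simp: A_def K_iff)
qed (simp_all add: A_def sgn_mult sgn_inv K_mult K_inv)

section \<open>The commutator sign as a symmetric bimultiplicative pairing\<close>

lemma kappa_self: "x \<in> carrier G \<Longrightarrow> kappa x x = 1"
  by (simp add: kappa_def G.m_assoc sgn_one)

lemma kappa_commute:
  assumes "x \<in> carrier G" "y \<in> carrier G"
  shows "kappa x y = kappa y x"
proof -
  have "inv (x \<otimes> y \<otimes> inv x \<otimes> inv y) = y \<otimes> x \<otimes> inv y \<otimes> inv x"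
    using assms by (simp add: G.inv_mult_group G.m_assoc)
  then show ?thesis
    using sgn_inv[OF comm_in_K[OF assms]] by (simp add: kappa_def)
qed

text \<open>Rests on the identity [x x', y] = x [x', y] x^-1 [x, y] and the invariance of the sign
  under conjugation.\<close>

lemma kappa_mult_left:
  assumes "x \<in> carrier G" "x' \<in> carrier G" "y \<in> carrier G"
  shows "kappa (x \<otimes> x') y = kappa x y * kappa x' y"
proof -
  have "(x \<otimes> x') \<otimes> y \<otimes> inv (x \<otimes> x') \<otimes> inv y =
      (x \<otimes> (x' \<otimes> y \<otimes> inv x' \<otimes> inv y) \<otimes> inv x) \<otimes> (x \<otimes> y \<otimes> inv x \<otimes> inv y)"
    using assms by (simp add: G.inv_mult_group G.m_assoc G.inv_mult_cancel_left)
  then show ?thesis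
    using assms by (simp add: kappa_def sgn_mult K_conj comm_in_K sgn_conj)
qed

lemma kappa_mult_right:
  assumes "x \<in> carrier G" "y \<in> carrier G" "y' \<in> carrier G"
  shows "kappa x (y \<otimes> y') = kappa x y * kappa x y'"
  using assms by (metis G.m_closed kappa_commute kappa_mult_left)

text \<open>The commutator is \<open>x\<close> times a conjugate of \<open>inv x\<close>, and both
  factors have the sign of \<open>x\<close>.\<close>

lemma kappa_K_left:
  assumes x: "x \<in> K" and y: "y \<in> carrier G"
  shows "kappa x y = 1"
proof -
  have "x \<otimes> y \<otimes> inv x \<otimes> inv y = x \<otimes> (y \<otimes> inv x \<otimes> inv y)"
    using assms by (simp add: G.m_assoc K_iff)
  then have "kappa x y = sgn x * sgn x"
    using assms by (simp add: kappa_def sgn_mult K_inv K_conj sgn_conj sgn_inv)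
  then show ?thesis using sgn_cases[OF x] by auto
qed

lemma kappa_K_right: "x \<in> carrier G \<Longrightarrow> y \<in> K \<Longrightarrow> kappa x y = 1"
  using kappa_K_left kappa_commute K_iff by metis

text \<open>The pairing depends only on classes modulo \<open>K\<close>, so it may be computed on
  any lifts.\<close>

lemma kappa_mult_K:
  "x \<in> carrier G \<Longrightarrow> y \<in> carrier G \<Longrightarrow> f \<in> K \<Longrightarrow> g \<in> K \<Longrightarrow>
    kappa (x \<otimes> f) (y \<otimes> g) = kappa x y"
  by (simp add: kappa_mult_left kappa_mult_right kappa_K_left kappa_K_right K_iff)

lemma kappa_pow_left:
  "x \<in> carrier G \<Longrightarrow> y \<in> carrier G \<Longrightarrow> kappa (x [^] (k::nat)) y = kappa x y ^ k"
  by (induction k) (simp_all add: kappa_mult_left kappa_K_left K_one mult.commute)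

lemma kappa_pow_right:
  "x \<in> carrier G \<Longrightarrow> y \<in> carrier G \<Longrightarrow> kappa x (y [^] (k::nat)) = kappa x y ^ k"
  using kappa_commute kappa_pow_left by simp

text \<open>Being a subgroup, this set allows triviality of \<open>kappa\<close> to be checked on
  generators and passed on to integer powers.\<close>

lemma kappa_centralizer:
  assumes y: "y \<in> carrier G"
  shows "subgroup {x \<in> carrier G. kappa x y = 1} G"
proof (rule G.subgroupI)
  show "{x \<in> carrier G. kappa x y = 1} \<noteq> {}"
    using kappa_self[OF y] y by blast
  fix x assume x: "x \<in> {x \<in> carrier G. kappa x y = 1}"
  then have "kappa (inv x) y * kappa x y = 1"
    using y kappa_K_left[OF K_one y] kappa_mult_left[of "inv x" x y] by simp
  with x show "inv x \<in> {x \<in> carrier G. kappa x y = 1}" by simp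
qed (use y in \<open>auto simp: kappa_mult_left\<close>)

section \<open>Subgroups containing \<open>A\<close>\<close>

lemma t_in_subgroup_if_kappa:
  assumes U: "subgroup U G" "A \<subseteq> U" and x: "x \<in> U" and y: "y \<in> U" and k: "kappa x y = - 1"
  shows "t \<in> U"
proof -
  let ?c = "x \<otimes> y \<otimes> inv x \<otimes> inv y"
  have car: "x \<in> carrier G" "y \<in> carrier G" using U(1) x y subgroup.mem_carrier by metis+
  have c: "?c \<in> U" "?c \<in> K"
    using U(1) x y comm_in_K[OF car] by (simp_all add: subgroup.m_closed subgroup.m_inv_closed)
  \<comment> \<open>The commutator \<open>?c\<close> and \<open>t\<close> are both odd, so their
    quotient is even.\<close>
  have "inv ?c \<otimes> t \<in> A"
    using k t c(2) by (simp add: A_def K_mult K_inv sgn_mult sgn_inv kappa_def del: G.inv_mult_group)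
  then have "?c \<otimes> (inv ?c \<otimes> t) \<in> U" using U c(1) by (meson subgroup.m_closed subsetD)
  then show ?thesis using c(2) t(1) by (simp add: K_iff flip: G.m_assoc)
qed

text \<open>\<open>A\<close> has index two in \<open>K\<close>, and every odd element lies in the
  coset of \<open>t\<close>.\<close>

lemma K_subset_if_t_mem:
  assumes U: "subgroup U G" "A \<subseteq> U" and tU: "t \<in> U"
  shows "K \<subseteq> U"
proof
  fix x assume x: "x \<in> K"
  show "x \<in> U"
  proof (cases "sgn x = 1")
    case True
    then show ?thesis using x U by (auto simp: A_def)
  next
    case False
    then have "inv t \<otimes> x \<in> A"
      using x t sgn_cases[OF x] by (simp add: A_def K_mult K_inv sgn_mult sgn_inv)
    then have "t \<otimes> (inv t \<otimes> x) \<in> U" using U tU by (meson subgroup.m_closed subsetD)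
    then show ?thesis using x t(1) by (simp add: K_iff flip: G.m_assoc)
  qed
qed

text \<open>Any odd element \<open>x\<close> of \<open>U\<close> would bring \<open>t\<close> into
  \<open>U\<close>, because \<open>inv x \<otimes> t\<close> is even. Hence \<open>U\<close> meets
  \<open>K\<close> in either \<open>K\<close> or \<open>A\<close>.\<close>

lemma inter_K_if_t_notin:
  assumes U: "subgroup U G" "A \<subseteq> U" and tU: "t \<notin> U"
  shows "U \<inter> K = A"
proof -
  have "x \<in> A" if x: "x \<in> U" "x \<in> K" for x
  proof (rule ccontr)
    assume "x \<notin> A"
    then have "inv x \<otimes> t \<in> A"
      using x t sgn_cases[OF x(2)] by (simp add: A_def K_mult K_inv sgn_mult sgn_inv)
    then have "x \<otimes> (inv x \<otimes> t) \<in> U" using U x(1) by (meson subgroup.m_closed subsetD)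
    then show False using x t(1) tU by (simp add: K_iff flip: G.m_assoc)
  qed
  then show ?thesis using U(2) A_subset_K by blast
qed

text \<open>An element \<open>v\<close> of \<open>U\<close> with the same image as \<open>u\<close>
  satisfies \<open>u = v \<otimes> f\<close> with \<open>f\<close> in \<open>K\<close>, and one of
  \<open>f\<close> and \<open>f \<otimes> t\<close> is even.\<close>

lemma lift_mem_cases:
  assumes U: "subgroup U G" "A \<subseteq> U" and u: "u \<in> carrier G" "h u \<in> h ` U"
  shows "u \<in> U \<or> u \<otimes> t \<in> U"
proof -
  obtain v where v: "v \<in> U" "h v = h u" using u(2) by force
  have vc: "v \<in> carrier G" by (rule subgroup.mem_carrier[OF U(1) v(1)])
  let ?f = "inv v \<otimes> u"
  have f: "?f \<in> K" using vc u v by (simp add: K_iff)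
  show ?thesis
  proof (cases "sgn ?f = 1")
    case True
    then have "?f \<in> U" using f U(2) by (auto simp: A_def)
    with v(1) have "v \<otimes> ?f \<in> U" by (rule subgroup.m_closed[OF U(1)])
    then show ?thesis using vc u by (simp flip: G.m_assoc)
  next
    case False
    then have "?f \<otimes> t \<in> A" using sgn_cases[OF f] f t by (simp add: A_def K_mult sgn_mult)
    then have "v \<otimes> (?f \<otimes> t) \<in> U" using v(1) U by (meson subgroup.m_closed subsetD)
    then show ?thesis using vc u t(1) by (simp add: K_iff flip: G.m_assoc)
  qed
qed

lemma conj_mem_if_kappa:
  assumes U: "subgroup U G" "A \<subseteq> U" and w: "w \<in> carrier G" and u: "u \<in> U" and k: "kappa w u = 1"
  shows "w \<otimes> u \<otimes> inv w \<in> U"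
proof -
  have uc: "u \<in> carrier G" using u U(1) subgroup.mem_carrier by metis
  have "w \<otimes> u \<otimes> inv w \<otimes> inv u \<in> A"
    using k comm_in_K[OF w uc] by (simp add: A_def kappa_def)
  then have "w \<otimes> u \<otimes> inv w \<otimes> inv u \<otimes> u \<in> U" using U u by (meson subgroup.m_closed subsetD)
  then show ?thesis using w uc by (simp add: G.m_assoc)
qed

text \<open>Powers of \<open>w\<close> normalize \<open>U\<close>, since their commutators with
  elements of \<open>U\<close> lie in \<open>A\<close>. This gives a normal form for the elements of
  the subgroup generated by \<open>U\<close> and \<open>w\<close>.\<close>

lemma subgroup_adjoin_commuting:
  assumes U: "subgroup U G" "A \<subseteq> U" and w: "w \<in> carrier G" and k: "\<And>u. u \<in> U \<Longrightarrow> kappa w u = 1"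
  shows "subgroup {u \<otimes> w [^] (m::int) | u m. u \<in> U} G" (is "subgroup ?N G")
proof (rule G.subgroupI)
  have car: "u \<in> carrier G" if "u \<in> U" for u using that U(1) subgroup.mem_carrier by metis
  have conj: "w [^] m \<otimes> u \<otimes> inv (w [^] m) \<in> U" if u: "u \<in> U" for u and m :: int
  proof (rule conj_mem_if_kappa[OF U _ u])
    have "w \<in> {x \<in> carrier G. kappa x u = 1}" using k[OF u] w by simp
    from G.subgroup_int_pow_closed[OF kappa_centralizer[OF car[OF u]] this]
    show "kappa (w [^] m) u = 1" by simp
  qed (use w in simp)
  show "?N \<subseteq> carrier G" using car w by auto
  show "?N \<noteq> {}" using subgroup.one_closed[OF U(1)] by blast
  fix a assume "a \<in> ?N"
  then obtain u and m :: int where a: "a = u \<otimes> w [^] m" and u: "u \<in> U" by blast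
  have "inv a = (w [^] (- m) \<otimes> inv u \<otimes> inv (w [^] (- m))) \<otimes> w [^] (- m)"
    using w car[OF u] by (simp add: a G.inv_mult_group G.int_pow_neg G.m_assoc)
  then show "inv a \<in> ?N"
    using conj[OF subgroup.m_inv_closed[OF U(1) u], of "- m"] by blast
  fix b assume "b \<in> ?N"
  then obtain v and l :: int where b: "b = v \<otimes> w [^] l" and v: "v \<in> U" by blast
  have "a \<otimes> b = (u \<otimes> (w [^] m \<otimes> v \<otimes> inv (w [^] m))) \<otimes> w [^] (m + l)"
    using w car[OF u] car[OF v] by (simp add: a b G.int_pow_mult G.m_assoc G.inv_mult_cancel_left)
  then show "a \<otimes> b \<in> ?N"
    using subgroup.m_closed[OF U(1) u conj[OF v, of m]] by blast
qed

section \<open>Counting subgroups with a given image\<close>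

lemma image_generate_A:
  "w ` J \<subseteq> carrier G \<Longrightarrow> h ` generate G (w ` J \<union> A) = generate H ((h \<circ> w) ` J)"
  by (rule image_generate_Un_kernel[OF _ A_subset_K subgroup.one_closed[OF A_subgroup]])

text \<open>The \<open>w j\<close> are adjoined to \<open>A\<close> one at a time. If
  \<open>t = u \<otimes> w j [^] m\<close>, applying \<open>h\<close> shows that
  \<open>h (w j) [^] m\<close> is generated by the other images. Independence then forces
  \<open>m = 0\<close>, so \<open>t\<close> was already present. Stating \<open>indep\<close> for
  all subsets \<open>J'\<close> lets the induction inherit it.\<close>

lemma t_notin_generate:
  assumes "finite J" and w: "\<And>j. j \<in> J \<Longrightarrow> w j \<in> carrier G"
    and k: "\<And>i j. i \<in> J \<Longrightarrow> j \<in> J \<Longrightarrow> kappa (w i) (w j) = 1"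
    and indep: "\<And>J' k (m::int). J' \<subseteq> J \<Longrightarrow> k \<in> J \<Longrightarrow> k \<notin> J' \<Longrightarrow>
      h (w k) [^]\<^bsub>H\<^esub> m \<in> generate H ((h \<circ> w) ` J') \<Longrightarrow> m = 0"
  shows "t \<notin> generate G (w ` J \<union> A)"
  using assms
proof (induction J)
  case empty
  have "generate G A = A"
    using G.generateI[OF A_subgroup, of A] by simp
  then show ?case using t_notin_A by simp
next
  case (insert j J)
  let ?U = "generate G (w ` J \<union> A)"
  let ?N = "{u \<otimes> w j [^] (m::int) | u m. u \<in> ?U}"
  have wj: "w j \<in> carrier G" and wJ: "w ` J \<subseteq> carrier G" using insert.prems(1) by auto
  have AG: "A \<subseteq> carrier G" using A_subset_K by (auto simp: K_iff)
  have U: "subgroup ?U G" "A \<subseteq> ?U"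
    using wJ AG by (auto intro!: G.generate_is_subgroup intro: generate.incl)
  have tU: "t \<notin> ?U"
  proof (rule insert.IH)
    fix J' k and m :: int
    assume "J' \<subseteq> J" "k \<in> J" "k \<notin> J'" "h (w k) [^]\<^bsub>H\<^esub> m \<in> generate H ((h \<circ> w) ` J')"
    then show "m = 0" using insert.prems(3)[of J' k m] by blast
  qed (use insert.prems(1,2) in auto)
  have "?U \<subseteq> {x \<in> carrier G. kappa x (w j) = 1}"
    by (rule G.generate_subgroup_incl[OF _ kappa_centralizer[OF wj]])
      (use insert.prems AG A_subset_K kappa_K_left[OF _ wj] in auto)
  then have kU: "kappa (w j) u = 1" if "u \<in> ?U" for u
    using that wj kappa_commute by force
  have N: "subgroup ?N G" by (rule subgroup_adjoin_commuting[OF U wj kU])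
  have UN: "?U \<subseteq> ?N"
  proof
    fix u assume u: "u \<in> ?U"
    then have "u = u \<otimes> w j [^] (0::int)" using subgroup.mem_carrier[OF U(1) u] by simp
    with u show "u \<in> ?N" by blast
  qed
  have "w j = \<one> \<otimes> w j [^] (1::int)" using wj by (simp add: G.int_pow_1)
  then have "w j \<in> ?N" using subgroup.one_closed[OF U(1)] by blast
  moreover have "w ` J \<union> A \<subseteq> ?U" by (auto intro: generate.incl)
  then have "w ` J \<union> A \<subseteq> ?N" using UN by (rule subset_trans)
  ultimately have "generate G (w ` insert j J \<union> A) \<subseteq> ?N"
    by (intro G.generate_subgroup_incl[OF _ N]) auto
  moreover have "t \<notin> ?N"
  proof
    assume "t \<in> ?N"
    then obtain u and m :: int where tu: "t = u \<otimes> w j [^] m" and u: "u \<in> ?U" by blast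
    have uc: "u \<in> carrier G" by (rule subgroup.mem_carrier[OF U(1) u])
    have "h u \<otimes>\<^bsub>H\<^esub> h (w j) [^]\<^bsub>H\<^esub> m = \<one>\<^bsub>H\<^esub>"
      using t(1) tu uc wj by (simp add: K_iff hom_int_pow)
    then have "h (w j) [^]\<^bsub>H\<^esub> m = h (inv u)"
      using uc wj by (metis H.inv_equality H.inv_inv H.int_pow_closed hom_closed hom_inv)
    moreover have "inv u \<in> ?U" using U(1) u by (rule subgroup.m_inv_closed)
    ultimately have "h (w j) [^]\<^bsub>H\<^esub> m \<in> generate H ((h \<circ> w) ` J)"
      using image_generate_A[OF wJ] by auto
    then have "m = 0" using insert.prems(3)[of J j m] insert.hyps(2) by blast
    then show False using tu u uc tU by simp
  qed
  ultimately show ?case by blast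
qed

text \<open>For each index exactly one of \<open>u j\<close> and \<open>u j \<otimes> t\<close> lies
  in \<open>U\<close>. Sending \<open>U\<close> to the set of indices where it is \<open>u j\<close>
  is a bijection onto the subsets of \<open>I\<close>.\<close>

theorem card_complements:
  assumes I: "finite I" and u: "\<And>i. i \<in> I \<Longrightarrow> u i \<in> carrier G"
    and k: "\<And>i j. i \<in> I \<Longrightarrow> j \<in> I \<Longrightarrow> kappa (u i) (u j) = 1"
    and indep: "\<And>J k (m::int). J \<subseteq> I \<Longrightarrow> k \<in> I \<Longrightarrow> k \<notin> J \<Longrightarrow>
      h (u k) [^]\<^bsub>H\<^esub> m \<in> generate H ((h \<circ> u) ` J) \<Longrightarrow> m = 0"
  shows "card {U. subgroup U G \<and> A \<subseteq> U \<and> t \<notin> U \<and> h ` U = generate H ((h \<circ> u) ` I)} = 2 ^ card I"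
    (is "card ?S = _")
proof -
  \<comment> \<open>The system of lifts prescribed by the subset \<open>B\<close>. All these systems
    have the same images and the same pairings.\<close>
  define w where "w B j = (if j \<in> B then u j else u j \<otimes> t)" for B j
  have tc: "t \<in> carrier G" "h t = \<one>\<^bsub>H\<^esub>" using t(1) by (auto simp: K_iff)
  have wc: "w B j \<in> carrier G" and hw: "h (w B j) = h (u j)" if "j \<in> I" for B j
    using that u tc by (auto simp: w_def)
  have himg: "(h \<circ> w B) ` J = (h \<circ> u) ` J" if "J \<subseteq> I" for B J
    using that hw by (auto simp: image_iff subset_iff)
  have kw: "kappa (w B i) (w B j) = 1" if "i \<in> I" "j \<in> I" for B i j
    using that u k tc t(1) by (auto simp: w_def kappa_mult_left kappa_mult_right kappa_K_left kappa_K_right)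
  have "bij_betw (\<lambda>U. {j \<in> I. u j \<in> U}) ?S (Pow I)"
  proof (rule bij_betw_imageI)
    show "inj_on (\<lambda>U. {j \<in> I. u j \<in> U}) ?S"
    proof (rule inj_onI)
      have sub: "U \<subseteq> V" if U: "U \<in> ?S" and V: "V \<in> ?S" and eq: "{j \<in> I. u j \<in> U} = {j \<in> I. u j \<in> V}" for U V
      proof -
        let ?B = "{j \<in> I. u j \<in> U}"
        have w_mem: "w ?B j \<in> U \<inter> V" if j: "j \<in> I" for j
        proof -
          have "h (u j) \<in> generate H ((h \<circ> u) ` I)" using j by (auto intro: generate.incl)
          then have "h (u j) \<in> h ` U" "h (u j) \<in> h ` V" using U V by auto
          then have "u j \<in> U \<or> u j \<otimes> t \<in> U" "u j \<in> V \<or> u j \<otimes> t \<in> V"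
            using U V u[OF j] by (auto dest: lift_mem_cases)
          then show ?thesis using eq j by (auto simp: w_def)
        qed
        \<comment> \<open>The intersection contains a lift of every generator and all of
          \<open>A\<close>, so it has the same image and the same kernel part as \<open>U\<close>,
          and equals \<open>U\<close>.\<close>
        have UV: "subgroup (U \<inter> V) G" using U V by (simp add: G.subgroups_Inter_pair)
        have "generate H ((h \<circ> w ?B) ` I) \<subseteq> h ` (U \<inter> V)"
          by (rule H.generate_subgroup_incl[OF _ subgroup_img_is_subgroup[OF UV]]) (use w_mem in auto)
        then have "h ` U \<subseteq> h ` (U \<inter> V)" using U himg by auto
        moreover have "U \<inter> K \<subseteq> U \<inter> V" using inter_K_if_t_notin[of U] U V by auto
        ultimately have "U \<subseteq> U \<inter> V"
          using subset_if_image_and_kernel_subset[OF _ UV] U by blast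
        then show ?thesis by blast
      qed
      show "U = V" if "U \<in> ?S" "V \<in> ?S" "{j \<in> I. u j \<in> U} = {j \<in> I. u j \<in> V}" for U V
        using that sub[of U V] sub[of V U] by blast
    qed
    show "(\<lambda>U. {j \<in> I. u j \<in> U}) ` ?S = Pow I"
    proof (intro subset_antisym subsetI)
      fix B assume "B \<in> Pow I"
      let ?U = "generate G (w B ` I \<union> A)"
      have car: "w B ` I \<subseteq> carrier G" using wc by auto
      have AG: "A \<subseteq> carrier G" using A_subset_K by (auto simp: K_iff)
      have U: "subgroup ?U G" "A \<subseteq> ?U"
        using car AG by (auto intro!: G.generate_is_subgroup intro: generate.incl)
      have tU: "t \<notin> ?U"
      proof (rule t_notin_generate[OF I wc kw])
        fix J' k and m :: int
        assume "J' \<subseteq> I" "k \<in> I" "k \<notin> J'" "h (w B k) [^]\<^bsub>H\<^esub> m \<in> generate H ((h \<circ> w B) ` J')"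
        then show "m = 0" using indep[of J' k m] himg hw by simp
      qed
      have "h ` ?U = generate H ((h \<circ> u) ` I)"
        using image_generate_A[OF car] himg by simp
      then have "?U \<in> ?S" using U tU by blast
      moreover have "{j \<in> I. u j \<in> ?U} = B"
      proof -
        have "u j \<in> ?U \<longleftrightarrow> j \<in> B" if j: "j \<in> I" for j
        proof
          have wU: "w B j \<in> ?U" using j by (auto intro: generate.incl)
          show "u j \<in> ?U" if "j \<in> B" using wU that by (simp add: w_def)
          show "j \<in> B" if uU: "u j \<in> ?U"
          proof (rule ccontr)
            assume "j \<notin> B"
            \<comment> \<open>Containing both lifts over \<open>j\<close> would force
              \<open>t\<close> into the subgroup.\<close>
            then have "inv (u j) \<otimes> (u j \<otimes> t) \<in> ?U"
              using wU uU U(1) by (simp add: w_def subgroup.m_closed subgroup.m_inv_closed)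
            then show False using tU u[OF j] tc by (simp flip: G.m_assoc)
          qed
        qed
        then show ?thesis using \<open>B \<in> Pow I\<close> by blast
      qed
      ultimately show "B \<in> (\<lambda>U. {j \<in> I. u j \<in> U}) ` ?S" by blast
    qed auto
  qed
  then have "card ?S = card (Pow I)" by (rule bij_betw_same_card)
  then show ?thesis using I by (simp add: card_Pow)
qed

text \<open>If \<open>t\<close> lies in \<open>U\<close>, then \<open>U\<close> contains
  \<open>K\<close> and is the full preimage \<open>?P\<close>. This is the one addition to the
  \<open>2 ^ card I\<close> subgroups that avoid \<open>t\<close>.\<close>

theorem card_subgroups_with_image:
  assumes I: "finite I" and u: "\<And>i. i \<in> I \<Longrightarrow> u i \<in> carrier G"
    and k: "\<And>i j. i \<in> I \<Longrightarrow> j \<in> I \<Longrightarrow> kappa (u i) (u j) = 1"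
    and indep: "\<And>J k (m::int). J \<subseteq> I \<Longrightarrow> k \<in> I \<Longrightarrow> k \<notin> J \<Longrightarrow>
      h (u k) [^]\<^bsub>H\<^esub> m \<in> generate H ((h \<circ> u) ` J) \<Longrightarrow> m = 0"
  shows "card {U. subgroup U G \<and> A \<subseteq> U \<and> h ` U = generate H ((h \<circ> u) ` I)} = 2 ^ card I + 1"
    (is "card ?S = _")
proof -
  let ?C = "{U. subgroup U G \<and> A \<subseteq> U \<and> t \<notin> U \<and> h ` U = generate H ((h \<circ> u) ` I)}"
  let ?P = "generate G (u ` I \<union> K)"
  have car: "u ` I \<subseteq> carrier G" using u by auto
  have P: "subgroup ?P G" "K \<subseteq> ?P"
    using car by (auto simp: K_iff intro!: G.generate_is_subgroup intro: generate.incl)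
  have "h ` ?P = generate H ((h \<circ> u) ` I)"
    using car K_one by (intro image_generate_Un_kernel) auto
  then have "?P \<in> ?S" using P A_subset_K by blast
  moreover have "U = ?P" if "U \<in> ?S" "t \<in> U" for U
    using that car K_subset_if_t_mem[of U] eq_generate_if_kernel_subset[of U u I] by blast
  ultimately have "?S = insert ?P ?C" by blast
  moreover have "?P \<notin> ?C" using P t(1) by blast
  moreover have "card ?C = 2 ^ card I" by (rule card_complements[OF assms])
  \<comment> \<open>Finiteness follows from the positive cardinality, and it makes the insertion of
    \<open>?P\<close> raise the cardinality by one.\<close>
  moreover from this have "finite ?C" by (intro card_ge_0_finite) simp
  ultimately show ?thesis by simp
qed

section \<open>Finite index from a finite colouring\<close>

lemma finite_rcosets_if_finite_coloring:
  assumes U: "subgroup U G" "A \<subseteq> U" and fin: "finite (col ` carrier G)"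
    and col: "\<And>x y. x \<in> carrier G \<Longrightarrow> y \<in> carrier G \<Longrightarrow> col x = col y \<Longrightarrow> h (x \<otimes> inv y) \<in> h ` U"
  shows "finite (rcosets U)"
proof -
  \<comment> \<open>One representative per colour. Each colour accounts for at most two cosets,
    depending on which lift of the quotient lies in \<open>U\<close>.\<close>
  define r where "r d = (SOME y. y \<in> carrier G \<and> col y = d)" for d
  have r: "r (col x) \<in> carrier G" "col (r (col x)) = col x" if "x \<in> carrier G" for x
    using someI[of "\<lambda>y. y \<in> carrier G \<and> col y = col x" x] that by (auto simp: r_def)
  have "rcosets U \<subseteq> (\<Union>d \<in> col ` carrier G. {U #> r d, U #> (inv t \<otimes> r d)})"
  proof
    fix R assume "R \<in> rcosets U"
    then obtain x where x: "x \<in> carrier G" and R: "R = U #> x" by (auto simp: RCOSETS_def)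
    let ?y = "r (col x)"
    have y: "?y \<in> carrier G" and tc: "t \<in> carrier G" using r x t(1) by (auto simp: K_iff)
    have "x \<otimes> inv ?y \<in> U \<or> x \<otimes> inv ?y \<otimes> t \<in> U"
      using x y r(2)[OF x] by (intro lift_mem_cases[OF U] col) auto
    then have "x \<in> U #> ?y \<or> x \<in> U #> (inv t \<otimes> ?y)"
    proof
      assume "x \<otimes> inv ?y \<in> U"
      moreover have "x = x \<otimes> inv ?y \<otimes> ?y" using x y by (simp add: G.m_assoc)
      ultimately show ?thesis unfolding r_coset_def by blast
    next
      assume "x \<otimes> inv ?y \<otimes> t \<in> U"
      moreover have "x = x \<otimes> inv ?y \<otimes> t \<otimes> (inv t \<otimes> ?y)"
        using x y tc G.inv_mult_cancel_left[of "inv t" ?y] by (simp add: G.m_assoc)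
      ultimately show ?thesis unfolding r_coset_def by blast
    qed
    then have "R = U #> ?y \<or> R = U #> (inv t \<otimes> ?y)"
      using R y tc G.repr_independence[OF _ _ U(1)] by auto
    then show "R \<in> (\<Union>d \<in> col ` carrier G. {U #> r d, U #> (inv t \<otimes> r d)})" using x by blast
  qed
  then show ?thesis by (rule finite_subset) (intro finite_UN_I fin finite.intros)
qed

end

section \<open>Subgroups containing the finitary alternating group\<close>

text \<open>\<open>g\<close> may have infinite support, so multiplicativity of \<open>sign\<close>
  cannot be applied to the three factors. The induction instead decomposes \<open>f\<close> into
  transpositions, whose conjugates are again transpositions.\<close>

lemma permutation_sign_conj:
  assumes g: "bij g" and f: "permutation f"
  shows "permutation (g \<circ> f \<circ> Hilbert_Choice.inv g) \<and> sign (g \<circ> f \<circ> Hilbert_Choice.inv g) = sign f"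
proof -
  obtain S where "f permutes S" and S: "finite S" using f by (auto simp: permutation_permutes)
  from this show ?thesis
  proof (induction rule: permutes_induct)
    case id
    have "g \<circ> id \<circ> Hilbert_Choice.inv g = id" using g by (metis bij_is_surj comp_id surj_iff)
    then show ?case by (simp only: permutation_id sign_id simp_thms)
  next
    case (swap a b p)
    have "g \<circ> (f \<circ> p) \<circ> Hilbert_Choice.inv g =
        (g \<circ> f \<circ> Hilbert_Choice.inv g) \<circ> (g \<circ> p \<circ> Hilbert_Choice.inv g)" for f
      using g by (simp add: fun_eq_iff bij_is_inj inv_f_f)
    from this[of "transpose a b"] have eq: "g \<circ> (transpose a b \<circ> p) \<circ> Hilbert_Choice.inv g =
        transpose (g a) (g b) \<circ> (g \<circ> p \<circ> Hilbert_Choice.inv g)"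
      unfolding transpose_conj[OF g] .
    have "permutation p" using S swap.hyps(4) by (rule permutes_imp_permutation)
    note pt = permutation_swap_id this
    have q: "permutation (g \<circ> p \<circ> Hilbert_Choice.inv g)" "sign (g \<circ> p \<circ> Hilbert_Choice.inv g) = sign p"
      using swap.IH by blast+
    have "g a \<noteq> g b" using g swap.hyps(3) by (simp add: bij_is_inj inj_eq)
    then show ?case
      unfolding eq sign_compose[OF permutation_swap_id q(1)] sign_compose[OF pt] q(2)
      by (intro conjI permutation_compose permutation_swap_id q(1))
        (use swap.hyps(3) in \<open>simp add: sign_swap_id\<close>)
  qed
qed

lemma permutation_FSym: "f \<in> FSym X \<Longrightarrow> permutation f"
  by (auto simp: FSym_def permutation permutes_bij)

lemma transpose_FSym: "a \<in> X \<Longrightarrow> b \<in> X \<Longrightarrow> transpose a b \<in> FSym X"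
  by (simp add: FSym_def transpose_permutes finite_support_transpose)

text \<open>Each bracket is a product of \<open>transpose z x\<close> and
  \<open>transpose z y\<close>, in some order, with \<open>z\<close> among \<open>p\<close>,
  \<open>q\<close>, \<open>r\<close>. These are the products that the pigeonhole argument
  supplies.\<close>

lemma three_cycle_word:
  assumes "distinct [p, q, r, x, y]"
  shows "transpose p r \<circ> transpose p q =
    (transpose q x \<circ> transpose q y) \<circ> ((transpose p y \<circ> transpose p x) \<circ>
      ((transpose r x \<circ> transpose r y) \<circ> (transpose q y \<circ> transpose q x)))"
    (is "?l = ?r")
proof
  fix z
  have ne: "p \<noteq> q" "p \<noteq> r" "p \<noteq> x" "p \<noteq> y" "q \<noteq> r" "q \<noteq> x" "q \<noteq> y" "r \<noteq> x" "r \<noteq> y" "x \<noteq> y"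
    using assms by auto
  consider "z = p" | "z = q" | "z = r" | "z = x" | "z = y"
    | "z \<noteq> p" "z \<noteq> q" "z \<noteq> r" "z \<noteq> x" "z \<noteq> y" by blast
  then show "?l z = ?r z"
    by cases (simp_all only: comp_apply transpose_apply_first transpose_apply_second
        transpose_apply_other ne ne[symmetric] not_False_eq_True)
qed

text \<open>The map \<open>col\<close> plays the role of \<open>f \<mapsto> U f\<close>. By the infinite pigeonhole principle there are
  \<open>x \<noteq> y\<close> such that \<open>(z x)\<close> and \<open>(z y)\<close> have the same colour for each of \<open>z = p, q, r\<close>, and the
  resulting three-cycles generate the three-cycle \<open>(p q r)\<close>.\<close>

locale finitely_colored =
  fixes X :: "'a set" and U :: "('a \<Rightarrow> 'a) set" and col :: "('a \<Rightarrow> 'a) \<Rightarrow> 'b"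
  assumes infinite_X: "infinite X"
    and comp: "\<And>f g. f \<in> U \<Longrightarrow> g \<in> U \<Longrightarrow> f \<circ> g \<in> U"
    and finite_col: "finite (col ` FSym X)"
    and col: "\<And>f g. f \<in> FSym X \<Longrightarrow> g \<in> FSym X \<Longrightarrow> col f = col g \<Longrightarrow> Hilbert_Choice.inv g \<circ> f \<in> U"
begin

lemma id_mem: "id \<in> U"
  using col[of id id] by (simp add: FSym_def permutes_id)

lemma three_cycle_mem:
  assumes X: "p \<in> X" "q \<in> X" "r \<in> X" and d: "distinct [p, q, r]"
  shows "transpose p r \<circ> transpose p q \<in> U"
proof -
  define c where "c x = (col (transpose p x), col (transpose q x), col (transpose r x))" for x
  let ?Y = "X - {p, q, r}"
  have "c ` ?Y \<subseteq> col ` FSym X \<times> col ` FSym X \<times> col ` FSym X"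
    using X by (auto simp: c_def transpose_FSym)
  then have "finite (c ` ?Y)" using finite_col by (meson finite_SigmaI finite_subset)
  moreover have "infinite ?Y" using infinite_X by simp
  ultimately obtain x where x: "x \<in> ?Y" and inf: "infinite {y \<in> ?Y. c y = c x}"
    using pigeonhole_infinite by blast
  obtain y where y: "y \<in> ?Y" "c y = c x" "y \<noteq> x"
  proof -
    have "infinite ({y \<in> ?Y. c y = c x} - {x})" using inf by simp
    from infinite_imp_nonempty[OF this] show ?thesis using that by blast
  qed
  \<comment> \<open>Transpositions are their own inverses, so equal colours give the product in both
    orders.\<close>
  have "transpose z x \<circ> transpose z y \<in> U \<and> transpose z y \<circ> transpose z x \<in> U" if "z \<in> {p, q, r}" for z
  proof -
    have "z \<in> X" "col (transpose z x) = col (transpose z y)" using that y X by (auto simp: c_def)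
    then show ?thesis
      using col[of "transpose z x" "transpose z y"] col[of "transpose z y" "transpose z x"] x y
      by (simp add: transpose_FSym)
  qed
  then have mem: "transpose z x \<circ> transpose z y \<in> U" "transpose z y \<circ> transpose z x \<in> U"
    if "z \<in> {p, q, r}" for z using that by blast+
  have "(transpose q x \<circ> transpose q y) \<circ> ((transpose p y \<circ> transpose p x) \<circ>
      ((transpose r x \<circ> transpose r y) \<circ> (transpose q y \<circ> transpose q x))) \<in> U"
    by (intro comp mem) simp_all
  then show ?thesis
    using d x y by (subst three_cycle_word[of p q r x y]) auto
qed

text \<open>Transpositions sharing a point compose to a three-cycle or to the identity. For disjoint
  ones, the cancelling pair of \<open>transpose c a\<close> and \<open>transpose a c\<close> is
  inserted in the middle.\<close>

lemma two_transpositions_mem: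
  assumes X: "a \<in> X" "b \<in> X" "c \<in> X" "d \<in> X" and ne: "a \<noteq> b" "c \<noteq> d"
  shows "transpose c d \<circ> transpose a b \<in> U"
proof -
  have share: "transpose p r \<circ> transpose p q \<in> U" if "p \<in> X" "q \<in> X" "r \<in> X" "p \<noteq> q" "p \<noteq> r" for p q r
    using that three_cycle_mem[of p q r] id_mem by (cases "q = r") auto
  consider "c = a" | "c = b" | "d = a" | "d = b" | "distinct [a, b, c, d]" using ne by auto
  then show ?thesis
  proof cases
    case 1
    then show ?thesis using share[of a b d] X ne by simp
  next
    case 2
    then show ?thesis using share[of b a d] X ne by (simp add: transpose_commute)
  next
    case 3
    then show ?thesis using share[of a b c] X ne by (simp add: transpose_commute)
  next
    case 4
    then show ?thesis using share[of b a c] X ne by (simp add: transpose_commute)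
  next
    case 5
    have "(transpose c d \<circ> transpose c a) \<circ> (transpose a c \<circ> transpose a b) \<in> U"
      using 5 X by (intro comp share) auto
    moreover have "(transpose c d \<circ> transpose c a) \<circ> (transpose a c \<circ> transpose a b) =
        transpose c d \<circ> transpose a b"
      by (simp add: fun_eq_iff transpose_commute[of c a])
    ultimately show ?thesis by simp
  qed
qed

lemma alternating_subset: "{f \<in> FSym X. sign f = 1} \<subseteq> U"
proof
  fix f assume "f \<in> {f \<in> FSym X. sign f = 1}"
  then have f: "f \<in> FSym X" and sf: "sign f = 1" by auto
  let ?S = "{x. f x \<noteq> x}"
  have S: "?S \<subseteq> X" using f by (auto simp: FSym_def permutes_def)
  have "f permutes ?S"
    using f by (intro bij_permutesI) (auto simp: FSym_def permutes_bij)
  moreover have "finite ?S" using f by (simp add: FSym_def)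
  \<comment> \<open>Adding a transposition changes the parity, so the induction must also say
    something about odd permutations.\<close>
  ultimately have "(sign f = 1 \<longrightarrow> f \<in> U) \<and>
      (sign f = - 1 \<longrightarrow> (\<forall>c\<in>X. \<forall>d\<in>X. c \<noteq> d \<longrightarrow> transpose c d \<circ> f \<in> U))"
  proof (induction rule: permutes_induct)
    case id
    show ?case using id_mem by (simp add: id_def)
  next
    case (swap a b p)
    have X: "a \<in> X" "b \<in> X" using swap S by blast+
    have "permutation p" using \<open>finite ?S\<close> swap.hyps(4) by (rule permutes_imp_permutation)
    then have sgn: "sign (transpose a b \<circ> p) = - sign p"
      using swap by (simp add: sign_compose permutation_swap_id sign_swap_id)
    show ?case
    proof (cases p rule: sign_cases)
      case even
      then have "p \<in> U" using swap.IH by blast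
      then have "transpose c d \<circ> (transpose a b \<circ> p) \<in> U" if "c \<in> X" "d \<in> X" "c \<noteq> d" for c d
        unfolding comp_assoc[symmetric]
        using that X swap.hyps(3) by (intro comp two_transpositions_mem)
      then show ?thesis unfolding sgn even by (metis one_neq_neg_one)
    next
      case odd
      then have "transpose a b \<circ> p \<in> U" using swap.hyps(3) swap.IH X by blast
      then show ?thesis unfolding sgn odd by (metis minus_minus one_neq_neg_one)
    qed
  qed
  then show "f \<in> U" using sf by simp
qed

end

section \<open>The lattice generated by multiples of the standard basis\<close>

lemma comm_group_int_power_group: "comm_group (int_power_group r)"
  using group_int_power_group[of r]
  by (intro group.group_comm_groupI) (auto simp: int_power_group_simps add.commute)

lemma int_power_group_pow:
  assumes x: "x \<in> carrier (int_power_group r)" and i: "i \<in> {1..r}"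
  shows "(x [^]\<^bsub>int_power_group r\<^esub> (m::int)) i = m * x i"
proof -
  have "(\<lambda>z. z i) \<in> hom (int_power_group r) integer_group"
    using i by (auto simp: hom_def int_power_group_simps)
  then interpret group_hom "int_power_group r" integer_group "\<lambda>z. z i"
    by (simp add: group_hom_def group_hom_axioms_def group_int_power_group)
  show ?thesis using hom_int_pow[OF x, of m] by simp
qed

lemma int_power_group_nat_pow:
  assumes "x \<in> carrier (int_power_group r)" and "i \<in> {1..r}"
  shows "(x [^]\<^bsub>int_power_group r\<^esub> (m::nat)) i = int m * x i"
  using int_power_group_pow[OF assms, of "int m"] by (simp add: int_pow_int)

lemma std_basis_carrier: "std_basis r j \<in> carrier (int_power_group r)"
  by (simp add: std_basis_def int_power_group_simps)

lemma std_basis_pow: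
  "std_basis r j [^]\<^bsub>int_power_group r\<^esub> (m::int) = (\<lambda>i\<in>{1..r}. if i = j then m else 0)"
  (is "?l = ?r")
proof
  interpret group "int_power_group r" by (rule group_int_power_group)
  fix i
  have "?l \<in> carrier (int_power_group r)" using std_basis_carrier by simp
  then have "?l i = undefined" if "i \<notin> {1..r}"
    using that by (auto simp: int_power_group_simps PiE_def extensional_def)
  then show "?l i = ?r i"
    using int_power_group_pow[OF std_basis_carrier] by (auto simp: std_basis_def)
qed

text \<open>Indices follow the Houghton generators, so \<open>k\<close> belongs to coordinate
  \<open>k - 1\<close>. The parameter \<open>J\<close> covers both the full lattice and the partial
  ones needed for independence.\<close>

abbreviation basis_multiples :: "nat \<Rightarrow> (nat \<Rightarrow> nat) \<Rightarrow> nat set \<Rightarrow> (nat \<Rightarrow> int) set"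
  where "basis_multiples r c J \<equiv> generate (int_power_group r)
    ((\<lambda>k. std_basis r (k - 1) [^]\<^bsub>int_power_group r\<^esub> c k) ` J)"

text \<open>Evaluation at coordinate \<open>k - 1\<close> is a homomorphism that kills each
  generator with index in \<open>J\<close>.\<close>

lemma basis_multiples_coord_zero:
  assumes z: "z \<in> basis_multiples r c J" and k: "k \<in> {2..r + 1}" "k \<notin> J" and J: "J \<subseteq> {2..r + 1}"
  shows "z (k - 1) = 0"
proof -
  let ?Z = "int_power_group r"
  interpret Z: group ?Z by (rule group_int_power_group)
  have "(\<lambda>z. z (k - 1)) \<in> hom ?Z integer_group"
    using k by (auto simp: hom_def int_power_group_simps)
  then interpret group_hom ?Z integer_group "\<lambda>z. z (k - 1)"
    by (simp add: group_hom_def group_hom_axioms_def group_int_power_group)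
  have "basis_multiples r c J \<subseteq> kernel ?Z integer_group (\<lambda>z. z (k - 1))"
  proof (rule Z.generate_subgroup_incl[OF _ subgroup_kernel], rule image_subsetI)
    fix j assume j: "j \<in> J"
    \<comment> \<open>Both indices are at least 2, so truncated subtraction does not merge
      them.\<close>
    then have "j - 1 \<noteq> k - 1" using k J by (cases "j = k") auto
    moreover have "(std_basis r (j - 1) [^]\<^bsub>?Z\<^esub> c j) (k - 1) = int (c j) * std_basis r (j - 1) (k - 1)"
      using k by (intro int_power_group_nat_pow std_basis_carrier) auto
    ultimately have "(std_basis r (j - 1) [^]\<^bsub>?Z\<^esub> c j) (k - 1) = 0"
      using k by (auto simp: std_basis_def)
    then show "std_basis r (j - 1) [^]\<^bsub>?Z\<^esub> c j \<in> kernel ?Z integer_group (\<lambda>z. z (k - 1))"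
      using std_basis_carrier by (simp add: kernel_def)
  qed
  then show ?thesis using z by (auto simp: kernel_def)
qed

text \<open>The vector \<open>z\<close> is assembled one coordinate at a time, each summand being a
  multiple of a generator.\<close>

lemma basis_multiples_if_dvd:
  assumes z: "z \<in> carrier (int_power_group r)" and dvd: "\<And>i. i \<in> {1..r} \<Longrightarrow> int (c (i + 1)) dvd z i"
  shows "z \<in> basis_multiples r c {2..r + 1}"
proof -
  let ?Z = "int_power_group r" and ?L = "basis_multiples r c {2..r + 1}"
  interpret Z: group ?Z by (rule group_int_power_group)
  have L: "subgroup ?L ?Z"
    using std_basis_carrier by (intro Z.generate_is_subgroup) auto
  have "(\<lambda>i\<in>{1..r}. if i \<in> J then z i else 0) \<in> ?L" if "finite J" "J \<subseteq> {1..r}" for J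
    using that
  proof (induction J)
    case empty
    then show ?case
      using subgroup.one_closed[OF L] by (simp only: int_power_group_simps empty_iff if_False)
  next
    case (insert j J)
    then obtain q where q: "z j = int (c (j + 1)) * q" using dvd[of j] by (auto elim: dvdE)
    let ?b = "std_basis r j [^]\<^bsub>?Z\<^esub> c (j + 1)"
    have "?b \<in> ?L" using insert.prems by (intro generate.incl image_eqI[of _ _ "j + 1"]) auto
    then have b: "?b [^]\<^bsub>?Z\<^esub> q \<in> ?L" by (rule Z.subgroup_int_pow_closed[OF L])
    have "?b [^]\<^bsub>?Z\<^esub> q = std_basis r j [^]\<^bsub>?Z\<^esub> z j"
      using Z.int_pow_pow[OF std_basis_carrier, of j "int (c (j + 1))" q] by (simp add: q int_pow_int)
    then have "(\<lambda>i\<in>{1..r}. if i = j then z j else 0) \<in> ?L" using b by (simp only: std_basis_pow)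
    moreover have "(\<lambda>i\<in>{1..r}. if i \<in> J then z i else 0) \<in> ?L" using insert by blast
    ultimately have "(\<lambda>i\<in>{1..r}. if i \<in> J then z i else 0) \<otimes>\<^bsub>?Z\<^esub>
        (\<lambda>i\<in>{1..r}. if i = j then z j else 0) \<in> ?L"
      by (intro subgroup.m_closed[OF L])
    also have "(\<lambda>i\<in>{1..r}. if i \<in> J then z i else 0) \<otimes>\<^bsub>?Z\<^esub>
        (\<lambda>i\<in>{1..r}. if i = j then z j else 0) = (\<lambda>i\<in>{1..r}. if i \<in> insert j J then z i else 0)"
      unfolding int_power_group_simps using insert.hyps by (intro restrict_ext) auto
    finally show ?case .
  qed
  from this[of "{1..r}"] have "(\<lambda>i\<in>{1..r}. if i \<in> {1..r} then z i else 0) \<in> ?L" by simp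
  also have "(\<lambda>i\<in>{1..r}. if i \<in> {1..r} then z i else 0) = z"
    using z by (auto simp: int_power_group_simps fun_eq_iff PiE_def extensional_def)
  finally show ?thesis .
qed

section \<open>The Houghton group as a sign extension\<close>

lemma houghton_inv_eq:
  assumes n: "2 \<le> n" and f: "f \<in> carrier (houghton_group n)"
  shows "inv\<^bsub>houghton_group n\<^esub> f = Hilbert_Choice.inv f"
  using f houghton_inv[OF n f] permutes_inv_o[OF houghton_permutes[OF n f]]
  by (intro group.inv_equality group_houghton_group[OF n]) auto

lemma sign_extension_houghton:
  assumes n: "2 \<le> n"
  shows "sign_extension (houghton_group n) (int_power_group (n - 1)) (houghton_proj n)
    sign (transpose (1, 1) (1, 2))"
proof -
  interpret group_hom "houghton_group n" "int_power_group (n - 1)" "houghton_proj n"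
    using houghton_proj_hom[OF n] group_houghton_group[OF n] group_int_power_group
    by (simp add: group_hom_def group_hom_axioms_def)
  show ?thesis
  proof (intro sign_extension.intro group_hom_axioms sign_extension_axioms.intro
      comm_group_int_power_group, unfold houghton_proj_kernel[OF n])
    fix x y assume "x \<in> FSym (houghton_space n)" "y \<in> FSym (houghton_space n)"
    then show "sign (x \<otimes>\<^bsub>houghton_group n\<^esub> y) = sign x * sign y"
      unfolding houghton_group_simps by (subst sign_compose) (auto simp: permutation_FSym)
  next
    fix g x assume g: "g \<in> carrier (houghton_group n)" and x: "x \<in> FSym (houghton_space n)"
    have "bij g" using houghton_permutes[OF n g] by (rule permutes_bij)
    \<comment> \<open>With products composed left to right, conjugation by \<open>g\<close> is the
      function \<open>inv g \<circ> x \<circ> g\<close>, so the conjugation lemma is applied to the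
      inverse of \<open>g\<close>.\<close>
    then have "bij (Hilbert_Choice.inv g)" "Hilbert_Choice.inv (Hilbert_Choice.inv g) = g"
      by (simp_all add: bij_imp_bij_inv inv_inv_eq)
    then show "sign (g \<otimes>\<^bsub>houghton_group n\<^esub> x \<otimes>\<^bsub>houghton_group n\<^esub> inv\<^bsub>houghton_group n\<^esub> g) = sign x"
      using permutation_sign_conj[of "Hilbert_Choice.inv g" x] permutation_FSym[OF x]
      unfolding houghton_group_simps houghton_inv_eq[OF n g] by (simp only: comp_assoc)
  next
    show "sign x = 1 \<or> sign x = - 1" for x :: "nat \<times> nat \<Rightarrow> nat \<times> nat"
      by (cases x rule: sign_cases) auto
    show "transpose (1, 1) (1, 2) \<in> FSym (houghton_space n)"
      using n by (intro transpose_FSym) (auto simp: houghton_space_def)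
  qed (simp_all add: sign_swap_id)
qed

text \<open>The generator applied first decides which of \<open>(i, 1)\<close> and
  \<open>(j, 1)\<close> ends at \<open>(1, 2)\<close> and which at \<open>(1, 1)\<close>. Elsewhere
  the two orders agree.\<close>

lemma transpose_comp_houghton_gens:
  assumes "2 \<le> i" "2 \<le> j" "i \<noteq> j"
  shows "transpose (1, 1) (1, 2) \<circ> (houghton_gen j \<circ> houghton_gen i) = houghton_gen i \<circ> houghton_gen j"
proof
  fix x :: "nat \<times> nat"
  obtain l m where x: "x = (l, m)" by (cases x)
  consider "m = 0" | "m \<ge> 1" "l = 1" | "l = i" "m = 1" | "l = i" "m \<ge> 2"
    | "l = j" "m = 1" | "l = j" "m \<ge> 2" | "m \<ge> 1" "l \<notin> {1, i, j}"
    by (atomize_elim, simp, arith)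
  then show "(transpose (1, 1) (1, 2) \<circ> (houghton_gen j \<circ> houghton_gen i)) x = (houghton_gen i \<circ> houghton_gen j) x"
    unfolding x by cases (use assms in \<open>simp_all add: houghton_gen_def transpose_def\<close>)
qed

text \<open>The commutator is a conjugate of the transposition, hence odd.\<close>

lemma kappa_houghton_gens:
  assumes n: "2 \<le> n" and ij: "i \<in> {2..n}" "j \<in> {2..n}" "i \<noteq> j"
  shows "sign_extension.kappa (houghton_group n) sign (houghton_gen j) (houghton_gen i) = - 1"
proof -
  interpret sign_extension "houghton_group n" "int_power_group (n - 1)" "houghton_proj n" sign
    "transpose (1, 1) (1, 2)" by (rule sign_extension_houghton[OF n])
  let ?a = "houghton_gen i" and ?b = "houghton_gen j" and ?t = "transpose (1, 1) (1, 2) :: nat \<times> nat \<Rightarrow> nat \<times> nat"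
  have mem: "?a \<in> carrier (houghton_group n)" "?b \<in> carrier (houghton_group n)"
    using ij by (auto intro: houghton_gen_mem)
  have tm: "?t \<in> carrier (houghton_group n)" by (rule houghton_transpose_base[OF n])
  have "?a \<otimes>\<^bsub>houghton_group n\<^esub> ?b \<otimes>\<^bsub>houghton_group n\<^esub> ?t = ?b \<otimes>\<^bsub>houghton_group n\<^esub> ?a"
    unfolding houghton_group_simps using ij by (intro transpose_comp_houghton_gens) auto
  then have "?b \<otimes>\<^bsub>houghton_group n\<^esub> ?a \<otimes>\<^bsub>houghton_group n\<^esub> inv\<^bsub>houghton_group n\<^esub> ?b
        \<otimes>\<^bsub>houghton_group n\<^esub> inv\<^bsub>houghton_group n\<^esub> ?a =
      (?a \<otimes>\<^bsub>houghton_group n\<^esub> ?b) \<otimes>\<^bsub>houghton_group n\<^esub> ?t \<otimes>\<^bsub>houghton_group n\<^esub> inv\<^bsub>houghton_group n\<^esub> (?a \<otimes>\<^bsub>houghton_group n\<^esub> ?b)"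
    using mem tm by (simp add: G.inv_mult_group G.m_assoc del: houghton_group_simps)
  then show ?thesis
    unfolding kappa_def using mem t(1) sgn_conj[of "?a \<otimes>\<^bsub>houghton_group n\<^esub> ?b" ?t]
    by (simp add: sign_swap_id del: houghton_group_simps)
qed

section \<open>Classification\<close>

text \<open>Colouring a finitary permutation by its right coset of \<open>U\<close> uses finitely
  many colours.\<close>

lemma alternating_subset_finite_index:
  assumes n: "2 \<le> n" and U: "finite_index_subgroup U (houghton_group n)"
  shows "{f \<in> FSym (houghton_space n). sign f = 1} \<subseteq> U"
proof -
  let ?G = "houghton_group n"
  interpret G: group ?G by (rule group_houghton_group[OF n])
  have sub: "subgroup U ?G" and fin: "finite (rcosets\<^bsub>?G\<^esub> U)"
    using U by (auto simp: finite_index_subgroup_def)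
  note FG = subsetD[OF FSym_subset_houghton[OF n]]
  interpret finitely_colored "houghton_space n" U "\<lambda>f. U #>\<^bsub>?G\<^esub> f"
  proof
    have "range (\<lambda>m. (1::nat, Suc m)) \<subseteq> houghton_space n" using n by (auto simp: houghton_space_def)
    moreover have "infinite (range (\<lambda>m. (1::nat, Suc m)))" by (intro range_inj_infinite) (simp add: inj_def)
    ultimately show "infinite (houghton_space n)" by (rule infinite_super)
    show "f \<circ> g \<in> U" if "f \<in> U" "g \<in> U" for f g
      using subgroup.m_closed[OF sub that(2,1)] by simp
    have "(\<lambda>f. U #>\<^bsub>?G\<^esub> f) ` FSym (houghton_space n) \<subseteq> rcosets\<^bsub>?G\<^esub> U"
      using FG by (auto simp: RCOSETS_def)
    then show "finite ((\<lambda>f. U #>\<^bsub>?G\<^esub> f) ` FSym (houghton_space n))" using fin by (rule finite_subset)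
    fix f g assume f: "f \<in> FSym (houghton_space n)" and g: "g \<in> FSym (houghton_space n)"
      and eq: "U #>\<^bsub>?G\<^esub> f = U #>\<^bsub>?G\<^esub> g"
    have "f \<in> U #>\<^bsub>?G\<^esub> g" using G.rcos_self[OF FG[OF f] sub] eq by simp
    then obtain v where v: "v \<in> U" and fv: "f = v \<otimes>\<^bsub>?G\<^esub> g" by (auto simp: r_coset_def)
    have "f \<otimes>\<^bsub>?G\<^esub> inv\<^bsub>?G\<^esub> g = v"
      using FG[OF g] subgroup.mem_carrier[OF sub v] unfolding fv by (simp add: G.m_assoc del: houghton_group_simps)
    \<comment> \<open>In the right-action convention this composition is the group product of
      \<open>f\<close> and the inverse of \<open>g\<close>.\<close>
    then show "Hilbert_Choice.inv g \<circ> f \<in> U" using v by (simp add: houghton_inv_eq[OF n FG[OF g]])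
  qed
  show ?thesis by (rule alternating_subset)
qed

text \<open>Trades finite index for containment of the alternating group. Conversely, as every
  \<open>c k\<close> is positive, the lattice has finite index and \<open>A\<close> has index two in
  the kernel, so such a \<open>U\<close> has finite index.\<close>

lemma houghton_subgroups_eq:
  assumes n: "2 \<le> n" and c: "\<forall>k\<in>{2..n}. c k \<ge> 1"
  shows "houghton_subgroups n c = {U. subgroup U (houghton_group n) \<and>
    {f \<in> FSym (houghton_space n). sign f = 1} \<subseteq> U \<and> houghton_proj n ` U = basis_multiples (n - 1) c {2..n}}"
    (is "_ = ?S")
proof -
  interpret sign_extension "houghton_group n" "int_power_group (n - 1)" "houghton_proj n" sign
    "transpose (1, 1) (1, 2)" by (rule sign_extension_houghton[OF n])
  have gens: "{std_basis (n - 1) (k - 1) [^]\<^bsub>int_power_group (n - 1)\<^esub> c k | k. k \<in> {2..n}} =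
      (\<lambda>k. std_basis (n - 1) (k - 1) [^]\<^bsub>int_power_group (n - 1)\<^esub> c k) ` {2..n}" by blast
  have A: "A = {f \<in> FSym (houghton_space n). sign f = 1}"
    unfolding A_def houghton_proj_kernel[OF n] ..
  have "finite_index_subgroup U (houghton_group n)" if U: "U \<in> ?S" for U
  proof -
    \<comment> \<open>Elements with equal residues have projections differing by a lattice
      vector.\<close>
    define col where "col x = (\<lambda>i\<in>{1..n - 1}. houghton_proj n x i mod int (c (i + 1)))" for x
    have cpos: "0 < int (c (i + 1))" if "i \<in> {1..n - 1}" for i
    proof -
      have "i + 1 \<in> {2..n}" using that by auto
      then show ?thesis using c by fastforce
    qed
    have "col ` carrier (houghton_group n) \<subseteq> (\<Pi>\<^sub>E i\<in>{1..n - 1}. {0..<int (c (i + 1))})"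
      using cpos by (auto simp: col_def)
    then have fin: "finite (col ` carrier (houghton_group n))"
      by (rule finite_subset) (intro finite_PiE, auto)
    have "finite (rcosets\<^bsub>houghton_group n\<^esub> U)"
    proof (rule finite_rcosets_if_finite_coloring[OF _ _ fin])
      fix x y assume x: "x \<in> carrier (houghton_group n)" and y: "y \<in> carrier (houghton_group n)"
        and eq: "col x = col y"
      let ?z = "houghton_proj n (x \<otimes>\<^bsub>houghton_group n\<^esub> inv\<^bsub>houghton_group n\<^esub> y)"
      have "?z = houghton_proj n x \<otimes>\<^bsub>int_power_group (n - 1)\<^esub> inv\<^bsub>int_power_group (n - 1)\<^esub> houghton_proj n y"
        using x y by (simp del: houghton_group_simps)
      also have "\<dots> = (\<lambda>i\<in>{1..n - 1}. houghton_proj n x i - houghton_proj n y i)"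
        using hom_closed[OF y] unfolding int_power_group_def by (auto intro!: restrict_ext)
      finally have z: "?z i = houghton_proj n x i - houghton_proj n y i" if "i \<in> {1..n - 1}" for i
        using that by simp
      have "int (c (i + 1)) dvd ?z i" if "i \<in> {1..n - 1}" for i
        using fun_cong[OF eq, of i] that by (simp only: z) (simp add: col_def mod_eq_dvd_iff)
      then have "?z \<in> basis_multiples (n - 1) c {2..n - 1 + 1}"
        using x y by (intro basis_multiples_if_dvd hom_closed) (auto simp del: houghton_group_simps)
      then show "?z \<in> houghton_proj n ` U" using U n by simp
    qed (use U A in auto)
    then show ?thesis using U by (simp add: finite_index_subgroup_def)
  qed
  then show ?thesis
    unfolding houghton_subgroups_def gens using alternating_subset_finite_index[OF n]
    by (auto simp: finite_index_subgroup_def)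
qed

theorem corollary2:
  fixes n :: nat and c :: "nat \<Rightarrow> nat"
  assumes "n \<ge> 2" and "\<forall>k\<in>{2..n}. c k \<ge> 1"
  shows "if card {k \<in> {2..n}. odd (c k)} \<ge> 2
    then \<forall>U\<in>houghton_subgroups n c.
      U = generate (houghton_group n)
        ({houghton_gen k [^]\<^bsub>houghton_group n\<^esub> c k | k. k \<in> {2..n}} \<union> FSym (houghton_space n))
    else card (houghton_subgroups n c) = 2 ^ (n - 1) + 1"
proof -
  note n = assms(1)
  let ?G = "houghton_group n" and ?Z = "int_power_group (n - 1)" and ?O = "{k \<in> {2..n}. odd (c k)}"
  interpret sign_extension ?G ?Z "houghton_proj n" sign "transpose (1, 1) (1, 2)"
    by (rule sign_extension_houghton[OF n])
  define u where "u k = houghton_gen k [^]\<^bsub>?G\<^esub> c k" for k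
  have gen: "houghton_gen k \<in> carrier ?G" if "k \<in> {2..n}" for k
    using that by (auto intro: houghton_gen_mem)
  then have u: "u k \<in> carrier ?G" if "k \<in> {2..n}" for k
    using that by (simp add: u_def)
  have hu: "houghton_proj n (u k) = std_basis (n - 1) (k - 1) [^]\<^bsub>?Z\<^esub> c k" if "k \<in> {2..n}" for k
    using that gen[OF that] houghton_proj_gen[of k n] by (simp add: u_def hom_nat_pow)
  have img: "generate ?Z ((houghton_proj n \<circ> u) ` J) = basis_multiples (n - 1) c J" if "J \<subseteq> {2..n}" for J
    using that hu by (intro arg_cong[of _ _ "generate ?Z"] image_cong) auto
  have kappa_u: "kappa (u i) (u j) = (- 1) ^ (c i * c j)" if "i \<in> {2..n}" "j \<in> {2..n}" "i \<noteq> j" for i j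
    using that gen kappa_houghton_gens[OF n, of j i]
    by (simp add: u_def kappa_pow_left kappa_pow_right mult.commute del: houghton_group_simps flip: power_mult)
  have A: "A = {f \<in> FSym (houghton_space n). sign f = 1}"
    unfolding A_def houghton_proj_kernel[OF n] ..
  have S: "houghton_subgroups n c = {U. subgroup U ?G \<and> A \<subseteq> U \<and>
      houghton_proj n ` U = generate ?Z ((houghton_proj n \<circ> u) ` {2..n})}"
    by (simp only: houghton_subgroups_eq[OF assms] A img[OF subset_refl])
  show ?thesis
  proof (split if_split, intro conjI impI ballI)
    fix U assume "2 \<le> card ?O" and U: "U \<in> houghton_subgroups n c"
    then obtain T where "T \<subseteq> ?O" "card T = 2" by (meson obtain_subset_with_card_n)
    then obtain i j where ij: "i \<in> ?O" "j \<in> ?O" "i \<noteq> j" by (auto simp: card_2_iff)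
    have sub: "subgroup U ?G" "A \<subseteq> U"
      and hU: "houghton_proj n ` U = generate ?Z ((houghton_proj n \<circ> u) ` {2..n})"
      using U unfolding S by auto
    \<comment> \<open>\<open>U\<close> may miss \<open>u k\<close> itself, but the kernel factor
      \<open>f\<close> does not affect \<open>kappa\<close>.\<close>
    have lift: "\<exists>f\<in>K. u k \<otimes>\<^bsub>?G\<^esub> f \<in> U" if k: "k \<in> {2..n}" for k
    proof -
      have "houghton_proj n (u k) \<in> houghton_proj n ` U"
        unfolding hU using k by (auto intro: generate.incl)
      then have "u k \<in> U \<or> u k \<otimes>\<^bsub>?G\<^esub> transpose (1, 1) (1, 2) \<in> U"
        by (rule lift_mem_cases[OF sub u[OF k]])
      then show ?thesis using t(1) K_one u[OF k] G.r_one by metis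
    qed
    obtain f g where f: "f \<in> K" "u i \<otimes>\<^bsub>?G\<^esub> f \<in> U" and g: "g \<in> K" "u j \<otimes>\<^bsub>?G\<^esub> g \<in> U"
      using lift ij by blast
    have "kappa (u i \<otimes>\<^bsub>?G\<^esub> f) (u j \<otimes>\<^bsub>?G\<^esub> g) = kappa (u i) (u j)"
      using u ij f(1) g(1) by (intro kappa_mult_K) auto
    also have "\<dots> = - 1" using ij by (simp add: kappa_u)
    finally have "transpose (1, 1) (1, 2) \<in> U" by (rule t_in_subgroup_if_kappa[OF sub f(2) g(2)])
    then have "U = generate ?G (u ` {2..n} \<union> K)"
      using u by (intro eq_generate_if_kernel_subset[OF sub(1) K_subset_if_t_mem[OF sub] _ hU]) auto
    also have "u ` {2..n} = {houghton_gen k [^]\<^bsub>?G\<^esub> c k | k. k \<in> {2..n}}" by (auto simp: u_def)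
    finally show "U = generate ?G
        ({houghton_gen k [^]\<^bsub>?G\<^esub> c k | k. k \<in> {2..n}} \<union> FSym (houghton_space n))"
      by (simp only: houghton_proj_kernel[OF n])
  next
    assume few: "\<not> 2 \<le> card ?O"
    have "card (houghton_subgroups n c) = 2 ^ card {2..n} + 1"
      unfolding S
    proof (rule card_subgroups_with_image)
      fix i j assume i: "i \<in> {2..n}" and j: "j \<in> {2..n}"
      show "kappa (u i) (u j) = 1"
      proof (cases "i = j")
        case True
        then show ?thesis using kappa_self[OF u[OF i]] by simp
      next
        case False
        \<comment> \<open>At most one exponent is odd, so \<open>c i * c j\<close> is even for
          distinct indices.\<close>
        have "\<not> (odd (c i) \<and> odd (c j))"
        proof
          assume "odd (c i) \<and> odd (c j)"
          then have "card {i, j} \<le> card ?O" using i j by (intro card_mono) auto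
          then show False using few False by simp
        qed
        then show ?thesis using kappa_u[OF i j False] by auto
      qed
    next
      fix J k and m :: int
      assume J: "J \<subseteq> {2..n}" and k: "k \<in> {2..n}" "k \<notin> J"
        and mem: "houghton_proj n (u k) [^]\<^bsub>?Z\<^esub> m \<in> generate ?Z ((houghton_proj n \<circ> u) ` J)"
      have k1: "k - 1 \<in> {1..n - 1}" using k by auto
      \<comment> \<open>Coordinate \<open>k - 1\<close> of the power is \<open>m * c k\<close>, and
        it vanishes because \<open>J\<close> omits \<open>k\<close>. Positivity of
        \<open>c k\<close> then gives \<open>m = 0\<close>.\<close>
      have "m * houghton_proj n (u k) (k - 1) = (houghton_proj n (u k) [^]\<^bsub>?Z\<^esub> m) (k - 1)"
        using int_power_group_pow[OF hom_closed[OF u[OF k(1)]] k1] by simp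
      also have "\<dots> = 0"
        using basis_multiples_coord_zero[of _ "n - 1" c J k] mem n k J unfolding img[OF J] by simp
      finally have "m * houghton_proj n (u k) (k - 1) = 0" .
      moreover have "houghton_proj n (u k) (k - 1) = int (c k)"
        using int_power_group_nat_pow[OF std_basis_carrier k1] k1 by (simp add: hu[OF k(1)] std_basis_def)
      ultimately show "m = 0" using assms(2) k by force
    qed (use u in auto)
    then show "card (houghton_subgroups n c) = 2 ^ (n - 1) + 1" using n by simp
  qed
qed

end
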